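(* Let $\mathbf{X}$ be a quasi-Polish space. Then $\mathbf{X}$ is $\nabla$-compact relative to some oracle if and only if $\mathbf{X}$ is $\nabla$-computably Noetherian relative to some oracle. That is, the map $\mathrm{isFull}:\Delta^0_2(\mathbf{X})\to\mathbb{S}^\nabla$ is computable relative to some oracle if and only if the map $\mathrm{id}_{\mathcal{O},\mathcal{K}}:\mathcal{O}(\mathbf{X})\to(\mathcal{K}(\mathbf{X}))^\nabla$ is well-defined and computable relative to some oracle.
   Context: Represented spaces. A represented space is a pair $\mathbf{X}=(X,\delta_{\mathbf{X}})$ of a set $X$ and a partial surjection $\delta_{\mathbf{X}}:\subseteq\mathbb{N}^{\mathbb{N}}\to X$; if $\delta_{\mathbf{X}}(p)=x$ then $p$ is a name of $x$. A map $f:\mathbf{X}\to\mathbf{Y}$ is computable (continuous) if there is a computable (continuous) partial $F:\subseteq\mathbb{N}^{\mathbb{N}}\to\mathbb{N}^{\mathbb{N}}$ (a realizer) with $\delta_{\mathbf{Y}}(F(p))=f(\delta_{\mathbf{X}}(p))$ for all $p\in\mathrm{dom}(\delta_{\mathbf X})$. Being computable relative to some oracle is the same as being continuous in this sense. Sierpi\'nski space $\mathbb{S}$ has underlying set $\{\top,\bot\}$ and $\delta_{\mathbb{S}}(0^\omega)=\bot$, $\delta_{\mathbb{S}}(p)=\top$ for $p\ne0^\omega$. $\mathcal{C}(\mathbf{X},\mathbf{Y})$ is the represented space of continuous functions, where $nq$ is a name of $f$ if the $n$-th oracle Turing machine with oracle $q$ computes a realizer of $f$. $\mathcal{O}(\mathbf{X})$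 is the space of open sets: $U\subseteq X$ is identified with its continuous characteristic function in $\mathcal{C}(\mathbf{X},\mathbb{S})$. $\mathcal{K}(\mathbf{X})$ is the space of saturated compact sets: a set $A\subseteq X$ equal to the intersection of all its open supersets and such that $\{U\in\mathcal{O}(\mathbf{X})\mid A\subseteq U\}\in\mathcal{O}(\mathcal{O}(\mathbf{X}))$ is identified with this element of $\mathcal{O}(\mathcal{O}(\mathbf{X}))$. Finitely many mindchanges. $\Delta:\subseteq\mathbb{N}^{\mathbb{N}}\to\mathbb{N}^{\mathbb{N}}$ is defined on sequences with only finitely many zeros by $\Delta(p)(n)=p(n+1+\max\{i\mid p(i)=0\})-1$ (with $\max\emptyset:=-1$), and $\mathbf{X}^\nabla:=(X,\delta_{\mathbf{X}}\circ\Delta)$. $\Delta^0_2(\mathbf{X})$ is the represented space of subsets $A\subseteq X$ whose characteristic function $\mathbf{X}\to\mathbb{S}^\nabla$ is continuous, represented via $\mathcal{C}(\mathbf{X},\mathbb{S}^\nabla)$. $\mathbf{X}$ is $\nabla$-compact if $\mathrm{isFull}:\Delta^0_2(\mathbf{X})\to\mathbb{S}^\nabla$, with $\mathrm{isFull}(X)=\top$ and $\mathrm{isFull}(A)=\bot$ for $A\neq X$, is computable. $\mathbf{X}$ is $\nabla$-computably Noetherian if $\mathrm{id}_{\mathcal{O},\mathcal{K}}:\mathcal{O}(\mathbf{X})\to(\mathcal{K}(\mathbf{X}))^\nabla$, $U\mapsto U$, is well-defined (every open set is compact) and computable. Quasi-Polish spaces. A (non-empty) topological space is quasi-Polish iff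 it is countably based and its topology comes from a Smyth-complete quasi-metric; equivalently (known), iff its topology is induced (as final topology) by an open admissible total representation $\delta_{\mathbf{X}}:\mathbb{N}^{\mathbb{N}}\to\mathbf{X}$; equivalently, iff it is homeomorphic to a $\boldsymbol{\Pi}^0_2$-subspace of $\mathcal{P}(\omega)$ with the Scott topology ($\boldsymbol{\Sigma}^0_2$ sets being countable unions of differences of open sets). A representation is admissible if $x\mapsto\{U\in\mathcal{O}(\mathbf{X})\mid x\in U\}:\mathbf{X}\to\mathcal{O}(\mathcal{O}(\mathbf{X}))$ has a continuous partial inverse. A quasi-Polish space is regarded as a represented space via such an open admissible total representation. *)

theory Defs
  imports "HOL-Analysis.Analysis" "HOL-Library.Nat_Bijection" "HOL-Library.FuncSet"
begin

section \<open>Oracle machines\<close>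

type_synonym baire = "nat \<Rightarrow> nat"

text \<open>
  Oracle Turing machines are given by their programs in a standard acceptable programming
  system: partial recursive functions of one argument, tuples being coded by
  \<^const>\<open>prod_encode\<close>, with two kinds of query, \<open>Oracle\<close> to the oracle \<open>q\<close> and \<open>Input\<close> to the
  input sequence \<open>p\<close>. In \<open>run q p\<close>, the value \<^const>\<open>None\<close> stands for divergence.
  In \<open>PrimRec f g\<close> the step function receives \<open>(a, (m, y))\<close>, where \<open>a\<close> is the parameter and \<open>y\<close>
  the value at \<open>m\<close>. The search \<open>Mu f\<close> requires \<open>f\<close> to converge at all arguments below the result.
\<close>

datatype prog =
    Zero | Successor | First | Second | Oracle | Input
  | Tuple prog prog | Compose prog prog | PrimRec prog prog | Mu prog

primrec run :: "baire \<Rightarrow> baire \<Rightarrow> prog \<Rightarrow> nat \<Rightarrow> nat option" where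
  "run q p Zero = (\<lambda>x. Some 0)"
| "run q p Successor = (\<lambda>x. Some (Suc x))"
| "run q p First = (\<lambda>x. Some (fst (prod_decode x)))"
| "run q p Second = (\<lambda>x. Some (snd (prod_decode x)))"
| "run q p Oracle = (\<lambda>x. Some (q x))"
| "run q p Input = (\<lambda>x. Some (p x))"
| "run q p (Tuple f g) = (\<lambda>x. Option.bind (run q p f x) (\<lambda>a.
     Option.bind (run q p g x) (\<lambda>b. Some (prod_encode (a, b)))))"
| "run q p (Compose f g) = (\<lambda>x. Option.bind (run q p g x) (run q p f))"
| "run q p (PrimRec f g) = (\<lambda>x. case prod_decode x of (a, n) \<Rightarrow>
     rec_nat (run q p f a)
       (\<lambda>m r. Option.bind r (\<lambda>y. run q p g (prod_encode (a, prod_encode (m, y))))) n)"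
| "run q p (Mu f) = (\<lambda>x.
     if \<exists>n. run q p f (prod_encode (x, n)) = Some 0
          \<and> (\<forall>m<n. \<exists>k. run q p f (prod_encode (x, m)) = Some (Suc k))
     then Some (LEAST n. run q p f (prod_encode (x, n)) = Some 0)
     else None)"

text \<open>An effective enumeration of the programs.\<close>

function prog_of_nat :: "nat \<Rightarrow> prog" where
  "prog_of_nat n =
     (if n = 0 then Zero else if n = 1 then Successor else if n = 2 then First
      else if n = 3 then Second else if n = 4 then Oracle else if n = 5 then Input
      else let m = (n - 6) div 4; a = fst (prod_decode m); b = snd (prod_decode m) in
        if (n - 6) mod 4 = 0 then Tuple (prog_of_nat a) (prog_of_nat b)
        else if (n - 6) mod 4 = 1 then Compose (prog_of_nat a) (prog_of_nat b)
        else if (n - 6) mod 4 = 2 then PrimRec (prog_of_nat a) (prog_of_nat b)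
        else Mu (prog_of_nat m))"
  by auto

lemma fst_prod_decode_le: "fst (prod_decode m) \<le> m"
  by (metis le_prod_encode_1 prod.collapse prod_decode_inverse)

lemma snd_prod_decode_le: "snd (prod_decode m) \<le> m"
  by (metis le_prod_encode_2 prod.collapse prod_decode_inverse)

termination
proof -
  have less: "(n - 6) div 4 < n" if "n \<noteq> 0" for n :: nat
    using that by linarith
  note bounds = less le_less_trans[OF fst_prod_decode_le less]
    le_less_trans[OF snd_prod_decode_le less]
  show ?thesis
    by (relation "Wellfounded.measure id")
      (simp_all only: wf_measure in_measure id_apply, (erule bounds)+)
qed

declare prog_of_nat.simps [simp del]

lemma prog_of_nat_add6:
  assumes "r < 4"
  shows "prog_of_nat (6 + (r + 4 * m)) =
    (let a = fst (prod_decode m); b = snd (prod_decode m) in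
       if r = 0 then Tuple (prog_of_nat a) (prog_of_nat b)
       else if r = 1 then Compose (prog_of_nat a) (prog_of_nat b)
       else if r = 2 then PrimRec (prog_of_nat a) (prog_of_nat b)
       else Mu (prog_of_nat m))"
proof -
  define n where "n = 6 + (r + 4 * m)"
  have "(n - 6) div 4 = m" "(n - 6) mod 4 = r"
    using assms by (simp_all add: n_def)
  moreover have "n \<noteq> 0" "n \<noteq> 1" "n \<noteq> 2" "n \<noteq> 3" "n \<noteq> 4" "n \<noteq> 5"
    by (simp_all add: n_def)
  ultimately have "prog_of_nat n =
    (let a = fst (prod_decode m); b = snd (prod_decode m) in
       if r = 0 then Tuple (prog_of_nat a) (prog_of_nat b)
       else if r = 1 then Compose (prog_of_nat a) (prog_of_nat b)
       else if r = 2 then PrimRec (prog_of_nat a) (prog_of_nat b)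
       else Mu (prog_of_nat m))"
    by (subst prog_of_nat.simps) (simp only: Let_def if_False)
  then show ?thesis unfolding n_def .
qed

lemma prog_of_nat_surj: "\<exists>n. prog_of_nat n = e"
proof (induction e)
  case Zero
  show ?case by (rule exI[of _ 0]) (simp add: prog_of_nat.simps)
next
  case Successor
  show ?case by (rule exI[of _ 1]) (simp add: prog_of_nat.simps)
next
  case First
  show ?case by (rule exI[of _ 2]) (simp add: prog_of_nat.simps)
next
  case Second
  show ?case by (rule exI[of _ 3]) (simp add: prog_of_nat.simps)
next
  case Oracle
  show ?case by (rule exI[of _ 4]) (simp add: prog_of_nat.simps)
next
  case Input
  show ?case by (rule exI[of _ 5]) (simp add: prog_of_nat.simps)
next
  case (Tuple f g)
  then obtain a b where "prog_of_nat a = f" "prog_of_nat b = g" by blast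
  then show ?case
    using prog_of_nat_add6[of 0 "prod_encode (a, b)"] by auto
next
  case (Compose f g)
  then obtain a b where "prog_of_nat a = f" "prog_of_nat b = g" by blast
  then show ?case
    using prog_of_nat_add6[of 1 "prod_encode (a, b)"] by auto
next
  case (PrimRec f g)
  then obtain a b where "prog_of_nat a = f" "prog_of_nat b = g" by blast
  then show ?case
    using prog_of_nat_add6[of 2 "prod_encode (a, b)"] by auto
next
  case (Mu f)
  then obtain a where "prog_of_nat a = f" by blast
  then show ?case
    using prog_of_nat_add6[of 3 a] by auto
qed

text \<open>The partial function on Baire space computed by the \<open>n\<close>-th machine with oracle \<open>q\<close>.\<close>

definition machine :: "nat \<Rightarrow> baire \<Rightarrow> baire \<rightharpoonup> baire" where
  "machine n q p =
     (if \<forall>k. run q p (prog_of_nat n) k \<noteq> None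
      then Some (\<lambda>k. the (run q p (prog_of_nat n) k)) else None)"


section \<open>Represented spaces\<close>

text \<open>
  A represented space is identified with its representation, a partial map from Baire space.
  The underlying set is the range of this map, which makes the representation surjective.
\<close>

type_synonym 'a rep_space = "baire \<rightharpoonup> 'a"

abbreviation points :: "'a rep_space \<Rightarrow> 'a set" where
  "points X \<equiv> ran X"

definition realizes :: "'a rep_space \<Rightarrow> 'b rep_space \<Rightarrow> (baire \<rightharpoonup> baire) \<Rightarrow> ('a \<Rightarrow> 'b) \<Rightarrow> bool" where
  "realizes X Y F f \<longleftrightarrow>
     (\<forall>p x. X p = Some x \<longrightarrow> (\<exists>r. F p = Some r \<and> Y r = Some (f x)))"

definition computable_rel :: "baire \<Rightarrow> 'a rep_space \<Rightarrow> 'b rep_space \<Rightarrow> ('a \<Rightarrow> 'b) \<Rightarrow> bool" where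
  "computable_rel q X Y f \<longleftrightarrow> (\<exists>n. realizes X Y (machine n q) f)"

definition rep_continuous :: "'a rep_space \<Rightarrow> 'b rep_space \<Rightarrow> ('a \<Rightarrow> 'b) \<Rightarrow> bool" where
  "rep_continuous X Y f \<longleftrightarrow>
     (\<exists>F. continuous_on (dom F) (\<lambda>p. the (F p)) \<and> realizes X Y F f)"

definition rep_subspace :: "'a rep_space \<Rightarrow> 'a set \<Rightarrow> 'a rep_space" where
  "rep_subspace X A = X |` {p. \<exists>x\<in>A. X p = Some x}"

definition Sierpinski :: "bool rep_space" where
  "Sierpinski p = Some (\<exists>i. p i \<noteq> 0)"

text \<open>
  Functions on the underlying set of \<open>X\<close> are the functions that are \<^const>\<open>undefined\<close>
  outside it, so that a name determines its function.
\<close>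

definition fun_space :: "'a rep_space \<Rightarrow> 'b rep_space \<Rightarrow> ('a \<Rightarrow> 'b) rep_space" where
  "fun_space X Y p =
     (if \<exists>f\<in>extensional (points X). realizes X Y (machine (p 0) (\<lambda>i. p (Suc i))) f
      then Some (THE f. f \<in> extensional (points X)
                        \<and> realizes X Y (machine (p 0) (\<lambda>i. p (Suc i))) f)
      else None)"

lemma realizes_unique:
  assumes "realizes X Y F f" "realizes X Y F g"
    and "f \<in> extensional (points X)" "g \<in> extensional (points X)"
  shows "f = g"
proof (rule extensionalityI[OF assms(3,4)])
  fix x assume "x \<in> points X"
  then obtain p where "X p = Some x" by (auto simp: ran_def)
  then show "f x = g x" using assms(1,2) unfolding realizes_def by fastforce
qed

lemma fun_space_eq_Some_iff:
  "fun_space X Y p = Some f \<longleftrightarrow>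
     f \<in> extensional (points X) \<and> realizes X Y (machine (p 0) (\<lambda>i. p (Suc i))) f"
proof -
  let ?P = "\<lambda>f. f \<in> extensional (points X) \<and> realizes X Y (machine (p 0) (\<lambda>i. p (Suc i))) f"
  have "(THE f. ?P f) = g" if "?P g" for g
    using that realizes_unique by (intro the_equality) blast+
  then show ?thesis unfolding fun_space_def by auto
qed

definition subsets_via :: "'a rep_space \<Rightarrow> bool rep_space \<Rightarrow> 'a set rep_space" where
  "subsets_via X S p = map_option (\<lambda>f. {x \<in> points X. f x}) (fun_space X S p)"

definition opens :: "'a rep_space \<Rightarrow> 'a set rep_space" where
  "opens X = subsets_via X Sierpinski"

definition open_supersets :: "'a rep_space \<Rightarrow> 'a set \<Rightarrow> 'a set set" where
  "open_supersets X A = {U \<in> points (opens X). A \<subseteq> U}"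

definition saturated :: "'a rep_space \<Rightarrow> 'a set \<Rightarrow> bool" where
  "saturated X A \<longleftrightarrow> A = \<Inter> (open_supersets X A)"

text \<open>
  A saturated set \<open>A\<close> is compact iff \<open>open_supersets X A\<close> is a point of \<open>opens (opens X)\<close>, and
  is then determined by it.
\<close>

definition compacts :: "'a rep_space \<Rightarrow> 'a set rep_space" where
  "compacts X p =
     (if \<exists>A \<subseteq> points X. saturated X A \<and> opens (opens X) p = Some (open_supersets X A)
      then Some (THE A. A \<subseteq> points X \<and> saturated X A
                        \<and> opens (opens X) p = Some (open_supersets X A))
      else None)"

lemma compacts_eq_Some_iff:
  "compacts X p = Some A \<longleftrightarrow>
     A \<subseteq> points X \<and> saturated X A \<and> opens (opens X) p = Some (open_supersets X A)"
proof -
  define P where "P A \<longleftrightarrow>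
    A \<subseteq> points X \<and> saturated X A \<and> opens (opens X) p = Some (open_supersets X A)" for A
  have unique: "A = B" if "P A" "P B" for A B
  proof -
    have "open_supersets X A = open_supersets X B"
      using that by (simp add: P_def)
    then have "\<Inter> (open_supersets X A) = \<Inter> (open_supersets X B)" by (rule arg_cong)
    moreover have "A = \<Inter> (open_supersets X A)" "B = \<Inter> (open_supersets X B)"
      using that by (simp_all only: P_def saturated_def)
    ultimately show ?thesis by (simp only:)
  qed
  have the: "(THE A. P A) = B" if "P B" for B
    by (rule the_equality[of P, OF that unique[OF _ that]])
  have "compacts X p = (if \<exists>A. P A then Some (THE A. P A) else None)"
    unfolding compacts_def P_def by simp
  then have "compacts X p = Some A \<longleftrightarrow> P A"
    using the by (cases "\<exists>A. P A") auto
  then show ?thesis unfolding P_def .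
qed


section \<open>Finitely many mindchanges\<close>

definition Delta :: "baire \<rightharpoonup> baire" where
  "Delta p =
     (let Z = {i. p i = 0}; s = (if Z = {} then 0 else Suc (Max Z)) in
      if finite Z then Some (\<lambda>n. p (n + s) - 1) else None)"

definition nabla :: "'a rep_space \<Rightarrow> 'a rep_space" where
  "nabla X = X \<circ>\<^sub>m Delta"

definition Delta02 :: "'a rep_space \<Rightarrow> 'a set rep_space" where
  "Delta02 X = subsets_via X (nabla Sierpinski)"

definition nabla_compact_rel :: "baire \<Rightarrow> 'a rep_space \<Rightarrow> bool" where
  "nabla_compact_rel q X \<longleftrightarrow>
     computable_rel q (Delta02 X) (nabla Sierpinski) (\<lambda>A. A = points X)"

definition nabla_Noetherian_rel :: "baire \<Rightarrow> 'a rep_space \<Rightarrow> bool" where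
  "nabla_Noetherian_rel q X \<longleftrightarrow>
     points (opens X) \<subseteq> points (compacts X)
     \<and> computable_rel q (opens X) (nabla (compacts X)) (\<lambda>U. U)"


section \<open>Quasi-Polish spaces\<close>

definition quasi_metric_on :: "'a set \<Rightarrow> ('a \<Rightarrow> 'a \<Rightarrow> real) \<Rightarrow> bool" where
  "quasi_metric_on S d \<longleftrightarrow>
     (\<forall>x\<in>S. \<forall>y\<in>S. 0 \<le> d x y)
     \<and> (\<forall>x\<in>S. \<forall>y\<in>S. x = y \<longleftrightarrow> d x y = 0 \<and> d y x = 0)
     \<and> (\<forall>x\<in>S. \<forall>y\<in>S. \<forall>z\<in>S. d x z \<le> d x y + d y z)"

text \<open>
  Smyth-completeness: every sequence that is Cauchy in the oriented sense converges in the
  symmetrized metric \<open>max (d x y) (d y x)\<close>. The topology of a quasi-metric has the balls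
  \<open>{y. d x y < \<epsilon>}\<close> as a base.
\<close>

definition Smyth_complete :: "'a set \<Rightarrow> ('a \<Rightarrow> 'a \<Rightarrow> real) \<Rightarrow> bool" where
  "Smyth_complete S d \<longleftrightarrow>
     (\<forall>\<sigma>::nat \<Rightarrow> 'a. range \<sigma> \<subseteq> S
        \<and> (\<forall>\<epsilon>>0. \<exists>N. \<forall>n\<ge>N. \<forall>m\<ge>n. d (\<sigma> n) (\<sigma> m) < \<epsilon>)
      \<longrightarrow> (\<exists>l\<in>S. (\<lambda>n. max (d l (\<sigma> n)) (d (\<sigma> n) l)) \<longlonglongrightarrow> 0))"

definition induced_by_quasi_metric :: "'a topology \<Rightarrow> ('a \<Rightarrow> 'a \<Rightarrow> real) \<Rightarrow> bool" where
  "induced_by_quasi_metric T d \<longleftrightarrow>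
     (\<forall>U. openin T U \<longleftrightarrow>
        U \<subseteq> topspace T \<and> (\<forall>x\<in>U. \<exists>\<epsilon>>0. \<forall>y\<in>topspace T. d x y < \<epsilon> \<longrightarrow> y \<in> U))"

definition quasi_Polish :: "'a topology \<Rightarrow> bool" where
  "quasi_Polish T \<longleftrightarrow>
     topspace T \<noteq> {} \<and> second_countable T
     \<and> (\<exists>d. quasi_metric_on (topspace T) d \<and> Smyth_complete (topspace T) d
            \<and> induced_by_quasi_metric T d)"

definition open_nbhds :: "'a rep_space \<Rightarrow> 'a \<Rightarrow> 'a set set" where
  "open_nbhds X x = {U \<in> points (opens X). x \<in> U}"

definition admissible :: "'a rep_space \<Rightarrow> bool" where
  "admissible X \<longleftrightarrow>
     (\<exists>g. rep_continuous (rep_subspace (opens (opens X)) (open_nbhds X ` points X)) X g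
          \<and> (\<forall>x\<in>points X. g (open_nbhds X x) = x))"

definition open_admissible_total_rep :: "'a topology \<Rightarrow> 'a rep_space \<Rightarrow> bool" where
  "open_admissible_total_rep T X \<longleftrightarrow>
     dom X = UNIV \<and> points X = topspace T
     \<and> (\<forall>U. openin T U \<longleftrightarrow> U \<subseteq> topspace T \<and> open {p. \<exists>x\<in>U. X p = Some x})
     \<and> (\<forall>P. open P \<longrightarrow> openin T {x. \<exists>p\<in>P. X p = Some x})
     \<and> admissible X"

end

theory Submission
  imports Defs
begin

text \<open>
  Relative to an oracle, computable means continuous, and both properties turn out to say that
  the open sets satisfy the ascending chain condition. Under this condition the finite
  approximations to an open set stabilize, so a name of it as a compact set is found with
  finitely many mindchanges. Further, by the Baire category theorem, outside every proper open
  set some basic open set is decided by a given \<open>\<Delta>\<^sup>0\<^sub>2\<close>-name without late mindchanges; collecting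
  such sets exhausts the space after finitely many steps and yields a finite certificate for
  being full or not. Conversely, along a strictly increasing chain of open sets one can code
  the question whether a sequence has infinitely many nonzero entries into \<open>isFull\<close>.
\<close>

section \<open>Prefixes and the use principle\<close>

text \<open>Totality makes the names of the points outside an open set a closed subset of Baire
  space, so a category argument applies to names. Openness makes the points named in a cylinder an
  open set, so whatever is verified on a cylinder can be added to the set collected so far. The
  obstacle to computing \<open>isFull\<close> is that the mindchanges are finite in number for each
  name of a point but unbounded over all names; category bounds them only locally. Finite
  certificates become usable in the limit because there are countably many and a wrong one is
  contradicted by a single value of the evaluation, hence by a finite part of the name: the least
  certificate not yet contradicted changes finitely often. Effectivity is no concern, since an
  oracle can tabulate every map whose entry \<open>k\<close> depends on the first \<open>k\<close>
  entries of the input.\<close>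

definition agree :: "nat \<Rightarrow> baire \<Rightarrow> baire \<Rightarrow> bool" where
  "agree n p p' \<longleftrightarrow> (\<forall>i<n. p i = p' i)"

lemma agree_refl [simp]: "agree n p p"
  by (simp add: agree_def)

lemma agree_sym: "agree n p p' \<Longrightarrow> agree n p' p"
  by (simp add: agree_def)

lemma agree_trans: "agree n p p' \<Longrightarrow> agree n p' p'' \<Longrightarrow> agree n p p''"
  by (simp add: agree_def)

lemma agree_mono: "agree n p p' \<Longrightarrow> m \<le> n \<Longrightarrow> agree m p p'"
  by (simp add: agree_def)

lemma open_baire_iff:
  "open (P :: baire set) \<longleftrightarrow> (\<forall>p\<in>P. \<exists>n. \<forall>p'. agree n p p' \<longrightarrow> p' \<in> P)"
proof
  assume P: "open P"
  show "\<forall>p\<in>P. \<exists>n. \<forall>p'. agree n p p' \<longrightarrow> p' \<in> P"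
  proof
    fix p assume "p \<in> P"
    then obtain S where S: "p \<in> (\<Pi>\<^sub>E i\<in>UNIV. S i)" "finite {i. S i \<noteq> (UNIV :: nat set)}"
        "(\<Pi>\<^sub>E i\<in>UNIV. S i) \<subseteq> P"
      using product_topology_open_contains_basis[of "\<lambda>i. euclidean" UNIV P p] P
      by (auto simp: open_fun_def)
    obtain n where n: "\<And>i. S i \<noteq> UNIV \<Longrightarrow> i < n"
      using S(2) by (auto simp: finite_nat_set_iff_bounded)
    have "p' \<in> P" if "agree n p p'" for p'
    proof -
      have "p i \<in> S i" for i using S(1) by (auto simp: PiE_iff)
      then have "p' i \<in> S i" for i
        using that n[of i] unfolding agree_def by (metis UNIV_I)
      then show ?thesis using S(3) by (auto simp: PiE_def)
    qed
    then show "\<exists>n. \<forall>p'. agree n p p' \<longrightarrow> p' \<in> P" by blast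
  qed
next
  assume local: "\<forall>p\<in>P. \<exists>n. \<forall>p'. agree n p p' \<longrightarrow> p' \<in> P"
  have cylinder: "open {p'. agree n p p'}" for n p
  proof -
    have "open ((\<lambda>p'. p' i) -` {p i} :: baire set)" for i
      by (intro open_vimage open_discrete continuous_on_product_coordinates)
    then have "open (\<Inter>i\<in>{..<n}. ((\<lambda>p'. p' i) -` {p i} :: baire set))"
      by (intro open_INT) auto
    also have "(\<Inter>i\<in>{..<n}. ((\<lambda>p'. p' i) -` {p i} :: baire set)) = {p'. agree n p p'}"
      by (auto simp: agree_def)
    finally show ?thesis .
  qed
  show "open P"
  proof (subst open_subopen, intro ballI)
    fix p assume "p \<in> P"
    then obtain n where "\<forall>p'. agree n p p' \<longrightarrow> p' \<in> P" using local by blast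
    then show "\<exists>U. open U \<and> p \<in> U \<and> U \<subseteq> P"
      using cylinder[of n p] by (intro exI[of _ "{p'. agree n p p'}"]) auto
  qed
qed

text \<open>A halting run makes finitely many queries. Phrasing the bound with
  \<open>eventually\<close> lets the bounds of subcomputations be merged without explicit
  maxima.\<close>

lemma run_use_eventually:
  "run q p e x = Some v \<Longrightarrow>
   \<forall>\<^sub>F N in sequentially. \<forall>q' p'. agree N q q' \<longrightarrow> agree N p p' \<longrightarrow> run q' p' e x = Some v"
proof (induction e arbitrary: x v)
  case Oracle
  then show ?case
    by (intro eventually_sequentiallyI[of "Suc x"]) (auto simp: agree_def)
next
  case Input
  then show ?case
    by (intro eventually_sequentiallyI[of "Suc x"]) (auto simp: agree_def)
next
  case (Tuple f g)
  then obtain a b where "run q p f x = Some a" "run q p g x = Some b" "v = prod_encode (a, b)"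
    by (auto simp: Option.bind_eq_Some_conv)
  with Tuple.IH[of x] have
    "\<forall>\<^sub>F N in sequentially. \<forall>q' p'. agree N q q' \<longrightarrow> agree N p p' \<longrightarrow> run q' p' f x = Some a"
    "\<forall>\<^sub>F N in sequentially. \<forall>q' p'. agree N q q' \<longrightarrow> agree N p p' \<longrightarrow> run q' p' g x = Some b"
    by blast+
  then show ?case
    by eventually_elim (auto simp: \<open>v = _\<close>)
next
  case (Compose f g)
  then obtain a where "run q p g x = Some a" "run q p f a = Some v"
    by (auto simp: Option.bind_eq_Some_conv)
  with Compose.IH have
    "\<forall>\<^sub>F N in sequentially. \<forall>q' p'. agree N q q' \<longrightarrow> agree N p p' \<longrightarrow> run q' p' g x = Some a"
    "\<forall>\<^sub>F N in sequentially. \<forall>q' p'. agree N q q' \<longrightarrow> agree N p p' \<longrightarrow> run q' p' f a = Some v"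
    by blast+
  then show ?case
    by eventually_elim auto
next
  case (PrimRec f g)
  obtain a n where x: "prod_decode x = (a, n)" by (cases "prod_decode x")
  define R where "R q p = rec_nat (run q p f a)
    (\<lambda>m r. Option.bind r (\<lambda>y. run q p g (prod_encode (a, prod_encode (m, y)))))" for q p
  have R_Suc: "R q p (Suc m) =
      Option.bind (R q p m) (\<lambda>y. run q p g (prod_encode (a, prod_encode (m, y))))" for q p m
    by (simp add: R_def)
  have "R q p n = Some v \<Longrightarrow>
    \<forall>\<^sub>F N in sequentially. \<forall>q' p'. agree N q q' \<longrightarrow> agree N p p' \<longrightarrow> R q' p' n = Some v" for v
  proof (induction n arbitrary: v)
    case 0
    then show ?case using PrimRec.IH(1)[of a v] by (simp add: R_def)
  next
    case (Suc m)
    then obtain y where "R q p m = Some y" "run q p g (prod_encode (a, prod_encode (m, y))) = Some v"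
      by (auto simp: R_Suc Option.bind_eq_Some_conv)
    then have
      "\<forall>\<^sub>F N in sequentially. \<forall>q' p'. agree N q q' \<longrightarrow> agree N p p' \<longrightarrow> R q' p' m = Some y"
      "\<forall>\<^sub>F N in sequentially. \<forall>q' p'. agree N q q' \<longrightarrow> agree N p p' \<longrightarrow>
        run q' p' g (prod_encode (a, prod_encode (m, y))) = Some v"
      using Suc.IH PrimRec.IH(2) by blast+
    then show ?case
      by eventually_elim (auto simp: R_Suc)
  qed
  moreover have "run q p (PrimRec f g) x = R q p n" for q p
    by (simp add: x R_def)
  ultimately show ?case using PrimRec.prems by presburger
next
  case (Mu f)
  define Q where "Q n q p \<longleftrightarrow> run q p f (prod_encode (x, n)) = Some 0
          \<and> (\<forall>m<n. \<exists>k. run q p f (prod_encode (x, m)) = Some (Suc k))" for n q p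
  have run_Mu: "run q p (Mu f) x = Some n" if "Q n q p" for n q p
  proof -
    have "(LEAST n. run q p f (prod_encode (x, n)) = Some 0) = n"
      using that unfolding Q_def by (intro Least_equality) (auto simp: not_le[symmetric])
    moreover have "\<exists>n. Q n q p" using that by blast
    ultimately show ?thesis unfolding Q_def by simp
  qed
  have "\<exists>n. Q n q p"
  proof (rule ccontr)
    assume "\<nexists>n. Q n q p"
    then have "run q p (Mu f) x = None" unfolding Q_def by simp
    then show False using Mu.prems by simp
  qed
  then obtain n where n: "Q n q p" by blast
  then have v: "v = n" using run_Mu Mu.prems by simp
  have "\<forall>\<^sub>F N in sequentially. \<forall>q' p'. agree N q q' \<longrightarrow> agree N p p' \<longrightarrow>
      run q' p' f (prod_encode (x, n)) = Some 0"
    using n Mu.IH unfolding Q_def by blast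
  moreover have "\<forall>\<^sub>F N in sequentially. \<forall>m\<in>{..<n}. \<forall>q' p'. agree N q q' \<longrightarrow> agree N p p' \<longrightarrow>
      (\<exists>k. run q' p' f (prod_encode (x, m)) = Some (Suc k))"
  proof (intro eventually_ball_finite ballI)
    fix m assume "m \<in> {..<n}"
    then obtain k where "run q p f (prod_encode (x, m)) = Some (Suc k)"
      using n unfolding Q_def by blast
    from Mu.IH[OF this] show "\<forall>\<^sub>F N in sequentially. \<forall>q' p'. agree N q q' \<longrightarrow> agree N p p' \<longrightarrow>
      (\<exists>k. run q' p' f (prod_encode (x, m)) = Some (Suc k))"
      by eventually_elim blast
  qed simp
  ultimately have "\<forall>\<^sub>F N in sequentially. \<forall>q' p'. agree N q q' \<longrightarrow> agree N p p' \<longrightarrow> Q n q' p'"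
    by eventually_elim (auto simp: Q_def)
  then show ?case
    by eventually_elim (use v run_Mu in blast)
qed auto

lemma run_use:
  assumes "run q p e x = Some v"
  obtains N where "\<And>q' p'. agree N q q' \<Longrightarrow> agree N p p' \<Longrightarrow> run q' p' e x = Some v"
  using eventually_happens[OF run_use_eventually[OF assms]] by auto

definition eval_at :: "baire \<Rightarrow> baire \<Rightarrow> nat \<Rightarrow> nat option" where
  "eval_at p r k = run (\<lambda>i. p (Suc i)) r (prog_of_nat (p 0)) k"

lemma machine_eq_Some_iff:
  "machine n q r = Some u \<longleftrightarrow> (\<forall>k. run q r (prog_of_nat n) k = Some (u k))"
proof
  assume "\<forall>k. run q r (prog_of_nat n) k = Some (u k)"
  then show "machine n q r = Some u" by (simp add: machine_def)
qed (auto simp: machine_def split: if_splits)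

lemma machine_name_eq_Some_iff:
  "machine (p 0) (\<lambda>i. p (Suc i)) r = Some u \<longleftrightarrow> (\<forall>k. eval_at p r k = Some (u k))"
  by (simp add: machine_eq_Some_iff eval_at_def)

lemma eval_at_use:
  assumes "eval_at p r k = Some v"
  obtains N where "\<And>p' r'. agree N p p' \<Longrightarrow> agree N r r' \<Longrightarrow> eval_at p' r' k = Some v"
proof -
  obtain N where N: "\<And>q' r'. agree N (\<lambda>i. p (Suc i)) q' \<Longrightarrow> agree N r r' \<Longrightarrow>
      run q' r' (prog_of_nat (p 0)) k = Some v"
    using assms run_use unfolding eval_at_def by blast
  \<comment> \<open>One entry more than \<open>N\<close>: the oracle is \<open>p\<close> shifted by
    one, and entry 0 must agree for the same program to be run.\<close>
  have "eval_at p' r' k = Some v" if "agree (Suc N) p p'" "agree (Suc N) r r'" for p' r'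
  proof -
    have "agree N (\<lambda>i. p (Suc i)) (\<lambda>i. p' (Suc i))" "agree N r r'" "p' 0 = p 0"
      using that by (auto simp: agree_def)
    then show ?thesis using N unfolding eval_at_def by simp
  qed
  then show ?thesis using that by blast
qed


section \<open>Computing local functions relative to an oracle\<close>

text \<open>Entry \<open>k\<close> is a function of finitely many numbers and so fits into a table.
  The constructions below meet this bound by delaying their output.\<close>

definition local_map :: "(baire \<Rightarrow> baire) \<Rightarrow> bool" where
  "local_map F \<longleftrightarrow> (\<forall>p p' k. agree k p p' \<longrightarrow> F p k = F p' k)"

primrec prefix_code :: "baire \<Rightarrow> nat \<Rightarrow> nat" where
  "prefix_code p 0 = 0"
| "prefix_code p (Suc m) = prod_encode (p m, prefix_code p m)"

lemma prefix_code_eq_iff: "prefix_code p k = prefix_code p' k \<longleftrightarrow> agree k p p'"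
  by (induction k) (auto simp: agree_def less_Suc_eq)

text \<open>\<open>Tuple First Second\<close> serves as the identity. Primitive recursion over the
  input yields the prefix code, and a single oracle query at the pair of \<open>k\<close> and this
  code gives the answer.\<close>

definition table_prog :: prog where
  "table_prog = Compose Oracle (Tuple (Tuple First Second)
     (Compose (PrimRec Zero
        (Tuple (Compose Input (Compose First Second)) (Compose Second Second)))
      (Tuple Zero (Tuple First Second))))"

lemma run_table_prog: "run q p table_prog k = Some (q (prod_encode (k, prefix_code p k)))"
proof -
  have "rec_nat (Some 0) (\<lambda>m r. Option.bind r (\<lambda>y. Some (prod_encode (p m, y)))) k
      = Some (prefix_code p k)"
    by (induction k) auto
  then show ?thesis by (simp add: table_prog_def)
qed

definition table :: "(baire \<Rightarrow> baire) \<Rightarrow> baire" where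
  "table F x = (case prod_decode x of (k, c) \<Rightarrow> F (SOME p. prefix_code p k = c) k)"

text \<open>Laid out as \<open>fun_space\<close> expects, so that it is a name of a function and its
  tail is an oracle.\<close>

definition name :: "(baire \<Rightarrow> baire) \<Rightarrow> baire" where
  "name F i = (case i of 0 \<Rightarrow> SOME n. prog_of_nat n = table_prog | Suc j \<Rightarrow> table F j)"

lemma prog_of_name: "prog_of_nat (name F 0) = table_prog"
  unfolding name_def using someI_ex[OF prog_of_nat_surj[of table_prog]] by simp

lemma machine_name:
  assumes "local_map F"
  shows "machine (name F 0) (\<lambda>i. name F (Suc i)) p = Some (F p)"
proof -
  have "table F (prod_encode (k, prefix_code p k)) = F p k" for k
  proof -
    have "prefix_code (SOME p'. prefix_code p' k = prefix_code p k) k = prefix_code p k"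
      using someI[of "\<lambda>p'. prefix_code p' k = prefix_code p k" p] by simp
    then have "agree k (SOME p'. prefix_code p' k = prefix_code p k) p"
      by (simp add: prefix_code_eq_iff)
    then show ?thesis using assms by (simp add: table_def local_map_def)
  qed
  then show ?thesis
    by (simp add: machine_eq_Some_iff prog_of_name run_table_prog) (simp add: name_def)
qed

text \<open>Table position \<open>j\<close> stores an output whose index
  \<open>fst (prod_decode j)\<close> is at most \<open>j\<close>, so a prefix of the name involves
  only early outputs.\<close>

lemma agree_name:
  assumes "\<And>p i. i < k \<Longrightarrow> F p i = F' p i"
  shows "agree k (name F) (name F')"
proof -
  have "table F j = table F' j" if "j < k" for j
    using that assms fst_prod_decode_le[of j] by (auto simp: table_def split: prod.split)
  then show ?thesis by (auto simp: agree_def name_def split: nat.split)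
qed

lemma computable_rel_local_map:
  assumes "local_map F" and "\<And>p x. X p = Some x \<Longrightarrow> Y (F p) = Some (f x)"
  shows "\<exists>q. computable_rel q X Y f"
proof -
  have "realizes X Y (machine (name F 0) (\<lambda>i. name F (Suc i))) f"
    by (simp add: realizes_def machine_name[OF assms(1)] assms(2))
  then show ?thesis unfolding computable_rel_def by blast
qed

lemma subsets_via_name:
  assumes "local_map F" "A \<subseteq> points X" and "\<And>r x. X r = Some x \<Longrightarrow> S (F r) = Some (x \<in> A)"
  shows "subsets_via X S (name F) = Some A"
proof -
  define f where "f = restrict (\<lambda>x. x \<in> A) (points X)"
  have "f x = (x \<in> A)" if "X r = Some x" for r x
    using that by (auto simp: f_def ran_def)
  then have "fun_space X S (name F) = Some f"
    using assms(3) by (auto simp: fun_space_eq_Some_iff realizes_def machine_name[OF assms(1)] f_def)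
  moreover have "{x \<in> points X. f x} = A"
    using assms(2) by (auto simp: f_def)
  ultimately show ?thesis by (simp add: subsets_via_def)
qed

lemma subsets_viaD:
  assumes "subsets_via X S p = Some A"
  shows "A \<subseteq> points X"
    and "X r = Some x \<Longrightarrow> \<exists>u. (\<forall>k. eval_at p r k = Some (u k)) \<and> S u = Some (x \<in> A)"
proof -
  obtain f where f: "fun_space X S p = Some f" "A = {x \<in> points X. f x}"
    using assms by (auto simp: subsets_via_def)
  then show "A \<subseteq> points X" by blast
  assume x: "X r = Some x"
  then have "f x = (x \<in> A)" using f(2) by (auto simp: ran_def)
  then show "\<exists>u. (\<forall>k. eval_at p r k = Some (u k)) \<and> S u = Some (x \<in> A)"
    using f(1) x by (fastforce simp: fun_space_eq_Some_iff realizes_def machine_name_eq_Some_iff)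
qed


section \<open>Sequences with finitely many mindchanges\<close>

text \<open>
  \<open>g k\<close> is the current guess at stage \<open>k\<close>. Every change of the guess is announced by a zero,
  after which the sequence belonging to the new guess is output from its start.
\<close>

definition last_change :: "(nat \<Rightarrow> 'c) \<Rightarrow> nat \<Rightarrow> nat" where
  "last_change g k = Max {j. j \<le> k \<and> (j = 0 \<or> g j \<noteq> g (j - 1))}"

definition mindchange :: "(nat \<Rightarrow> 'c) \<Rightarrow> ('c \<Rightarrow> baire) \<Rightarrow> baire" where
  "mindchange g c k =
     (if last_change g k = k then 0 else Suc (c (g k) (k - Suc (last_change g k))))"

lemma mindchange_cong:
  assumes "\<And>i. i \<le> k \<Longrightarrow> g i = g' i" and "\<And>i. i < k \<Longrightarrow> c (g k) i = c' (g k) i"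
  shows "mindchange g c k = mindchange g' c' k"
proof -
  have "{j. j \<le> k \<and> (j = 0 \<or> g j \<noteq> g (j - 1))} = {j. j \<le> k \<and> (j = 0 \<or> g' j \<noteq> g' (j - 1))}"
    using assms(1) by auto
  then have eq: "last_change g k = last_change g' k" by (simp add: last_change_def)
  have "last_change g k \<in> {j. j \<le> k \<and> (j = 0 \<or> g j \<noteq> g (j - 1))}"
    unfolding last_change_def by (rule Max_in) auto
  then have "last_change g k \<noteq> k \<Longrightarrow> k - Suc (last_change g k) < k" by auto
  then show ?thesis using assms eq by (auto simp: mindchange_def)
qed

text \<open>Zeros stand exactly at stage 0 and at the changes, of which a settling guess has
  finitely many; what \<open>Delta\<close> keeps is the output for the final guess.\<close>

lemma Delta_mindchange:
  assumes "\<And>k. K \<le> k \<Longrightarrow> g k = a"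
  shows "Delta (mindchange g c) = Some (c a)"
proof -
  define Z where "Z = {j. j = 0 \<or> g j \<noteq> g (j - 1)}"
  have "j \<le> K" if "j \<in> Z" for j
  proof (rule ccontr)
    assume "\<not> j \<le> K"
    then have "K \<le> j" "K \<le> j - 1" "j \<noteq> 0" by auto
    then show False using that assms by (simp add: Z_def)
  qed
  then have fin: "finite Z" by (meson finite_nat_set_iff_bounded_le)
  have ne: "0 \<in> Z" by (simp add: Z_def)
  have last: "last_change g k = Max {j \<in> Z. j \<le> k}" for k
    unfolding last_change_def Z_def by (rule arg_cong[where f = Max]) auto
  have zero: "mindchange g c k = 0 \<longleftrightarrow> k \<in> Z" for k
  proof -
    have "last_change g k \<in> {j \<in> Z. j \<le> k}"
      unfolding last using ne fin by (intro Max_in) auto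
    moreover have "last_change g k = k" if "k \<in> Z"
      unfolding last using that fin by (intro Max_eqI) auto
    ultimately show ?thesis by (auto simp: mindchange_def)
  qed
  define s where "s = Suc (Max Z)"
  have tail: "mindchange g c (n + s) - 1 = c a n" for n
  proof -
    have "{j \<in> Z. j \<le> n + s} = Z"
      using Max_ge[OF fin] by (auto simp: s_def intro: le_SucI trans_le_add2)
    then have l: "last_change g (n + s) = Max Z" by (simp add: last)
    have const: "g (m + s) = g s" for m
    proof (induction m)
      case (Suc m)
      have "Suc (m + s) \<notin> Z" using Max_ge[OF fin, of "Suc (m + s)"] by (auto simp: s_def)
      then show ?case using Suc by (simp add: Z_def)
    qed simp
    have "g (n + s) = g (K + s)" using const by metis
    also have "\<dots> = a" using assms by simp
    finally show ?thesis unfolding mindchange_def l by (simp add: s_def)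
  qed
  have "{i. mindchange g c i = 0} = Z" using zero by auto
  then show ?thesis
    using fin ne tail by (auto simp: Delta_def Let_def s_def)
qed

lemma nabla_mindchange:
  assumes "\<And>k. K \<le> k \<Longrightarrow> g k = a" and "Y (c a) = Some y"
  shows "nabla Y (mindchange g c) = Some y"
  using Delta_mindchange[where c = c, OF assms(1)] assms(2) by (simp add: nabla_def)

text \<open>\<open>s\<close> is the position after the last zero, or 0 if there is none. Since
  \<open>Delta\<close> subtracts 1, an entry 1 is silent and an entry of at least 2 signals
  acceptance.\<close>

lemma nabla_SierpinskiD:
  assumes "nabla Sierpinski u = Some b"
  shows "\<exists>s. (\<forall>n. Suc n = s \<longrightarrow> u n = 0) \<and> (\<forall>n\<ge>s. u n \<noteq> 0) \<and> (b \<longleftrightarrow> (\<exists>j\<ge>s. 2 \<le> u j))"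
proof -
  define Z where "Z = {i. u i = 0}"
  define s where "s = (if Z = {} then 0 else Suc (Max Z))"
  have fin: "finite Z"
    using assms by (auto simp: nabla_def Delta_def map_comp_def Z_def Let_def
        split: if_splits option.splits)
  then have D: "Delta u = Some (\<lambda>n. u (n + s) - 1)"
    unfolding Delta_def Let_def Z_def[symmetric] s_def[symmetric] by simp
  have b: "b \<longleftrightarrow> (\<exists>n. u (n + s) - 1 \<noteq> 0)"
    using assms D by (simp add: nabla_def Sierpinski_def)
  have "u n = 0" if "Suc n = s" for n
    using that Max_in[OF fin] by (auto simp: s_def Z_def split: if_splits)
  moreover have "u n \<noteq> 0" if "s \<le> n" for n
    using that Max_ge[OF fin, of n] by (auto simp: s_def Z_def split: if_splits)
  moreover have "b \<longleftrightarrow> (\<exists>j\<ge>s. 2 \<le> u j)"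
  proof
    assume b
    then obtain n where "u (n + s) - 1 \<noteq> 0" using b by blast
    then show "\<exists>j\<ge>s. 2 \<le> u j" by (intro exI[of _ "n + s"]) auto
  next
    assume "\<exists>j\<ge>s. 2 \<le> u j"
    then obtain j where "s \<le> j" "2 \<le> u j" by blast
    then have "u ((j - s) + s) - 1 \<noteq> 0" by simp
    then show b using b by blast
  qed
  ultimately show ?thesis by blast
qed

text \<open>Here \<open>s\<close> may lie beyond the last zero: an accepting entry after it counts
  all the same.\<close>

lemma nabla_Sierpinski_TrueI:
  assumes "nabla Sierpinski u = Some b"
    and "\<And>n. s \<le> n \<Longrightarrow> u n \<noteq> 0" "s \<le> j" "2 \<le> u j"
  shows b
proof -
  obtain s' where s': "\<forall>n. Suc n = s' \<longrightarrow> u n = 0" "\<forall>n\<ge>s'. u n \<noteq> 0"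
      "b \<longleftrightarrow> (\<exists>j\<ge>s'. 2 \<le> u j)"
    using nabla_SierpinskiD[OF assms(1)] by blast
  have "s' \<le> s"
  proof (cases s')
    case (Suc n)
    then have "u n = 0" using s'(1) by simp
    then have "\<not> s \<le> n" using assms(2) by blast
    then show ?thesis using Suc by simp
  qed simp
  then show b using s'(3) assms(3,4) le_trans by blast
qed

text \<open>Here \<open>s\<close> is exact: the zero just before it rules out an accepting entry
  between the last zero and \<open>s\<close>.\<close>

lemma nabla_Sierpinski_FalseI:
  assumes "nabla Sierpinski u = Some b"
    and "\<And>n. s \<le> n \<Longrightarrow> u n = 1" and "\<And>n. Suc n = s \<Longrightarrow> u n = 0"
  shows "\<not> b"
proof
  assume b
  obtain s' where s': "\<forall>n. Suc n = s' \<longrightarrow> u n = 0" "\<forall>n\<ge>s'. u n \<noteq> 0"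
      "b \<longleftrightarrow> (\<exists>j\<ge>s'. 2 \<le> u j)"
    using nabla_SierpinskiD[OF assms(1)] by blast
  have "s \<le> s'"
  proof (cases s)
    case (Suc n)
    then have "u n = 0" using assms(3) by simp
    then have "\<not> s' \<le> n" using s'(2) by blast
    then show ?thesis using Suc by simp
  qed simp
  then show False using s'(3) \<open>b\<close> assms(2) by fastforce
qed

text \<open>
  The Baire category theorem for a nonempty closed set \<open>D\<close>, applied to its cover by the
  closed sets of those \<open>r\<close> for which \<open>u r\<close> has no zero from position \<open>s\<close> on.
\<close>

lemma Baire_no_late_zeros:
  fixes u :: "baire \<Rightarrow> baire"
  assumes "r0 \<in> D"
    and closed: "\<And>r. (\<And>N. \<exists>r'\<in>D. agree N r r') \<Longrightarrow> r \<in> D"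
    and cont: "\<And>r k. \<exists>N. \<forall>r'. agree N r r' \<longrightarrow> u r' k = u r k"
    and fin: "\<And>r. r \<in> D \<Longrightarrow> \<exists>s. \<forall>n\<ge>s. u r n \<noteq> 0"
  shows "\<exists>r\<in>D. \<exists>N s. \<forall>r'\<in>D. agree N r r' \<longrightarrow> (\<forall>n\<ge>s. u r' n \<noteq> 0)"
proof (rule ccontr)
  assume "\<not> ?thesis"
  then have late: "\<forall>r\<in>D. \<forall>N s. \<exists>r'\<in>D. agree N r r' \<and> (\<exists>n\<ge>s. u r' n = 0)"
    by simp
  \<comment> \<open>A state is a point of \<open>D\<close> with the length of its frozen prefix;
    step \<open>i\<close> forces a zero at some position from \<open>i\<close> on throughout the new
    cylinder.\<close>
  define P where "P = (\<lambda>(i::nat) (x :: baire \<times> nat). fst x \<in> D)"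
  define Q where "Q = (\<lambda>(i::nat) (x :: baire \<times> nat) (y :: baire \<times> nat).
    agree (snd x) (fst x) (fst y) \<and> snd x < snd y \<and>
    (\<exists>n\<ge>i. \<forall>r'. agree (snd y) (fst y) r' \<longrightarrow> u r' n = 0))"
  have "\<exists>f. \<forall>i. P i (f i) \<and> Q i (f i) (f (Suc i))"
  proof (rule dependent_nat_choice)
    show "\<exists>x. P 0 x" using assms(1) by (auto simp: P_def)
    fix x i assume "P i x"
    then obtain r' n where r': "r' \<in> D" "agree (snd x) (fst x) r'" "i \<le> n" "u r' n = 0"
      using late by (fastforce simp: P_def)
    obtain N where "\<forall>r''. agree N r' r'' \<longrightarrow> u r'' n = u r' n" using cont by blast
    then have "\<forall>r''. agree (max N (Suc (snd x))) r' r'' \<longrightarrow> u r'' n = 0"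
      using r'(4) agree_mono max.cobounded1 by metis
    then have "Q i x (r', max N (Suc (snd x)))"
      using r' by (auto simp: Q_def)
    then show "\<exists>y. P (Suc i) y \<and> Q i x y"
      using r'(1) by (auto simp: P_def)
  qed
  then obtain f where P: "\<And>i. P i (f i)" and Q: "\<And>i. Q i (f i) (f (Suc i))" by blast
  define R where "R i = fst (f i)" for i
  define M where "M i = snd (f i)" for i
  have R: "R i \<in> D" for i using P[of i] by (simp add: P_def R_def)
  have Q': "agree (M i) (R i) (R (Suc i))" "M i < M (Suc i)"
      "\<exists>n\<ge>i. \<forall>r'. agree (M (Suc i)) (R (Suc i)) r' \<longrightarrow> u r' n = 0" for i
    using Q[of i] by (auto simp: Q_def R_def M_def)
  have M_mono: "i \<le> j \<Longrightarrow> M i \<le> M j" for i j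
    by (rule lift_Suc_mono_le) (use Q'(2) less_imp_le in auto)
  have M_ge: "i \<le> M i" for i
    by (induction i) (use Q'(2) in \<open>auto simp: less_eq_Suc_le intro: order_trans\<close>)
  have R_agree: "agree (M i) (R i) (R j)" if "i \<le> j" for i j
    using that
  proof (induction j rule: dec_induct)
    case (step j)
    then show ?case using Q'(1)[of j] M_mono agree_mono agree_trans by meson
  qed simp
  define l where "l i = R (Suc i) i" for i
  have l: "agree (M i) (R i) l" for i
    unfolding agree_def
  proof (intro allI impI)
    fix m assume m: "m < M i"
    have "m < M (Suc m)" using M_ge[of "Suc m"] by simp
    then have "R (Suc m) m = R (max i (Suc m)) m" "R i m = R (max i (Suc m)) m"
      using R_agree[of "Suc m" "max i (Suc m)"] R_agree[of i "max i (Suc m)"] m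
      by (auto simp: agree_def)
    then show "R i m = l m" by (simp add: l_def)
  qed
  have "l \<in> D"
  proof (rule closed)
    fix N
    have "agree N l (R N)" using l[of N] M_ge agree_mono agree_sym by blast
    then show "\<exists>r'\<in>D. agree N l r'" using R by blast
  qed
  then obtain s where s: "\<forall>n\<ge>s. u l n \<noteq> 0" using fin by blast
  obtain n where "n \<ge> s" "u l n = 0" using Q'(3)[of s] l[of "Suc s"] by blast
  then show False using s by blast
qed

lemma prefix_bound:
  assumes "\<And>k. \<exists>N. \<forall>r'. agree N r r' \<longrightarrow> u r' k = u r k"
  shows "\<exists>N. \<forall>r'. agree N r r' \<longrightarrow> (\<forall>k<m. u r' k = u r (k :: nat))"
proof (induction m)
  case (Suc m)
  then obtain N where N: "\<forall>r'. agree N r r' \<longrightarrow> (\<forall>k<m. u r' k = u r k)" by blast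
  obtain N' where N': "\<forall>r'. agree N' r r' \<longrightarrow> u r' m = u r m" using assms by blast
  have "\<forall>r'. agree (max N N') r r' \<longrightarrow> (\<forall>k<Suc m. u r' k = u r k)"
    using N N' agree_mono[OF _ max.cobounded1] agree_mono[OF _ max.cobounded2]
    by (metis less_Suc_eq)
  then show ?case by blast
qed simp


section \<open>Total open representations\<close>

locale total_open_rep =
  fixes T :: "'a topology" and X :: "'a rep_space"
  assumes dom_X: "dom X = UNIV"
    and points_X: "points X = topspace T"
    and final: "openin T U \<longleftrightarrow> U \<subseteq> topspace T \<and> open {p. \<exists>x\<in>U. X p = Some x}"
    and open_map: "open P \<Longrightarrow> openin T {x. \<exists>p\<in>P. X p = Some x}"
begin

definition pt :: "baire \<Rightarrow> 'a" where
  "pt r = the (X r)"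

lemma X_eq: "X r = Some (pt r)"
  using dom_X unfolding pt_def by (metis UNIV_I domD option.sel)

lemma points_eq: "points X = range pt"
  by (auto simp: ran_def X_eq)

lemma pt_in_points [simp]: "pt r \<in> points X"
  by (simp add: points_eq)

lemma openin_pt_iff:
  "openin T U \<longleftrightarrow> U \<subseteq> points X \<and> (\<forall>r. pt r \<in> U \<longrightarrow> (\<exists>N. \<forall>r'. agree N r r' \<longrightarrow> pt r' \<in> U))"
  by (simp add: final points_X open_baire_iff X_eq)

lemma openin_pt_image:
  assumes "\<And>r. r \<in> P \<Longrightarrow> \<exists>N. \<forall>r'. agree N r r' \<longrightarrow> r' \<in> P"
  shows "openin T (pt ` P)"
proof -
  have "openin T {x. \<exists>p\<in>P. X p = Some x}"
    using assms by (intro open_map) (simp add: open_baire_iff)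
  moreover have "{x. \<exists>p\<in>P. X p = Some x} = pt ` P" by (auto simp: X_eq)
  ultimately show ?thesis by simp
qed

definition noetherian :: bool where
  "noetherian \<longleftrightarrow> (\<forall>V :: nat \<Rightarrow> 'a set.
     (\<forall>k. openin T (V k)) \<longrightarrow> (\<forall>k. V k \<subseteq> V (Suc k)) \<longrightarrow> (\<exists>k. V k = \<Union> (range V)))"

text \<open>
  The points that the name \<open>p\<close> of an open set is seen to accept from its first \<open>k\<close> entries
  and the first \<open>k\<close> entries of a name of the point.
\<close>

definition approx :: "baire \<Rightarrow> nat \<Rightarrow> 'a set" where
  "approx p k = pt ` {r. \<exists>j. \<forall>p' r'. agree k p p' \<longrightarrow> agree k r r' \<longrightarrow>
     (\<exists>v. v \<noteq> 0 \<and> eval_at p' r' j = Some v)}"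

lemma approx_local: "agree k p p' \<Longrightarrow> approx p k = approx p' k"
  unfolding approx_def by (metis agree_sym agree_trans)

lemma openin_approx: "openin T (approx p k)"
  unfolding approx_def
  by (rule openin_pt_image) (blast intro: agree_trans)

lemma approx_mono: "k \<le> l \<Longrightarrow> approx p k \<subseteq> approx p l"
  unfolding approx_def by (intro image_mono Collect_mono) (meson agree_mono)

text \<open>Soundness evaluates at \<open>p\<close> and \<open>r\<close> themselves. Conversely, an
  accepting computation has a finite use, and its bound is a stage at which the point
  appears.\<close>

lemma UN_approx:
  assumes "opens X p = Some U"
  shows "(\<Union>k. approx p k) = U"
proof -
  note D = subsets_viaD[OF assms[unfolded opens_def]]
  have sound: "pt r \<in> U" if seen: "\<forall>p' r'. agree k p p' \<longrightarrow> agree k r r' \<longrightarrow>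
     (\<exists>v. v \<noteq> 0 \<and> eval_at p' r' j = Some v)" for k r j
  proof -
    obtain u where u: "\<forall>k. eval_at p r k = Some (u k)" "Sierpinski u = Some (pt r \<in> U)"
      using D(2)[OF X_eq] by blast
    obtain v where "v \<noteq> 0" "eval_at p r j = Some v"
      using seen agree_refl by blast
    then have "u j \<noteq> 0" using u(1) by simp
    then show ?thesis using u(2) by (auto simp: Sierpinski_def)
  qed
  have accepted: "\<exists>k. pt r \<in> approx p k" if r: "pt r \<in> U" for r
  proof -
    obtain u where u: "\<forall>k. eval_at p r k = Some (u k)" "Sierpinski u = Some (pt r \<in> U)"
      using D(2)[OF X_eq] by blast
    then obtain j where j: "u j \<noteq> 0" using r by (auto simp: Sierpinski_def)
    obtain N where "\<And>p' r'. agree N p p' \<Longrightarrow> agree N r r' \<Longrightarrow> eval_at p' r' j = Some (u j)"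
      using eval_at_use[of p r j "u j"] u(1) by blast
    then have "pt r \<in> approx p N" using j unfolding approx_def by blast
    then show ?thesis by blast
  qed
  have "(\<Union>k. approx p k) \<subseteq> U" unfolding approx_def using sound by blast
  moreover have "U \<subseteq> (\<Union>k. approx p k)"
  proof
    fix x assume "x \<in> U"
    moreover from this obtain r where "x = pt r" using D(1) unfolding points_eq by blast
    ultimately show "x \<in> (\<Union>k. approx p k)" using accepted[of r] by blast
  qed
  ultimately show ?thesis by (rule subset_antisym)
qed

text \<open>Entry \<open>k\<close> consults only \<open>V k\<close>, so sequences of sets that agree
  below \<open>N\<close> get names that agree below \<open>N\<close>.\<close>

definition open_name :: "(nat \<Rightarrow> 'a set) \<Rightarrow> baire" where
  "open_name V = name (\<lambda>r k. if \<forall>r'. agree k r r' \<longrightarrow> pt r' \<in> V k then 1 else 0)"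

lemma opens_open_name:
  assumes V: "\<And>k. openin T (V k)" and mono: "\<And>k. V k \<subseteq> V (Suc k)"
  shows "opens X (open_name V) = Some (\<Union>k. V k)"
  unfolding opens_def open_name_def
proof (rule subsets_via_name)
  show "local_map (\<lambda>r k. if \<forall>r'. agree k r r' \<longrightarrow> pt r' \<in> V k then 1 else 0)"
    unfolding local_map_def
  proof (intro allI impI)
    fix p p' k assume "agree k p p'"
    then have "agree k p r \<longleftrightarrow> agree k p' r" for r
      using agree_sym agree_trans by blast
    then show "(if \<forall>r'. agree k p r' \<longrightarrow> pt r' \<in> V k then 1 else 0 :: nat) =
        (if \<forall>r'. agree k p' r' \<longrightarrow> pt r' \<in> V k then 1 else 0)" by simp
  qed
  show "(\<Union>k. V k) \<subseteq> points X" using V by (auto simp: openin_pt_iff)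
  have "(\<exists>k. \<forall>r'. agree k r r' \<longrightarrow> pt r' \<in> V k) \<longleftrightarrow> (\<exists>k. pt r \<in> V k)" for r
  proof
    assume "\<exists>k. pt r \<in> V k"
    then obtain k N where N: "\<forall>r'. agree N r r' \<longrightarrow> pt r' \<in> V k"
      using V openin_pt_iff by blast
    have "V k \<subseteq> V (max k N)" by (rule lift_Suc_mono_le[of V, OF mono]) simp
    then have "\<forall>r'. agree (max k N) r r' \<longrightarrow> pt r' \<in> V (max k N)"
      using N agree_mono max.cobounded2 by blast
    then show "\<exists>k. \<forall>r'. agree k r r' \<longrightarrow> pt r' \<in> V k" by blast
  qed (use agree_refl in blast)
  then show "Sierpinski (\<lambda>k. if \<forall>r'. agree k r r' \<longrightarrow> pt r' \<in> V k then 1 else 0) =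
      Some (x \<in> (\<Union>k. V k))" if "X r = Some x" for r x
    using that by (auto simp: Sierpinski_def X_eq)
qed

lemma points_opens: "points (opens X) = {U. openin T U}"
proof (intro set_eqI iffI)
  fix U assume "U \<in> points (opens X)"
  then obtain p where "opens X p = Some U" by (auto simp: ran_def)
  then have "U = (\<Union>k. approx p k)" using UN_approx by simp
  then show "U \<in> {U. openin T U}" using openin_approx by auto
next
  fix U assume "U \<in> {U. openin T U}"
  then have "opens X (open_name (\<lambda>k. U)) = Some U"
    using opens_open_name[of "\<lambda>k. U"] by simp
  then show "U \<in> points (opens X)" by (auto simp: ran_def)
qed


section \<open>Noetherian spaces and \<open>id\<close> from open to compact sets\<close>

lemma approx_stabilizes:
  assumes noetherian "opens X p = Some U"
  obtains K where "\<And>k. K \<le> k \<Longrightarrow> approx p k = U"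
proof -
  obtain K where K: "approx p K = \<Union> (range (approx p))"
    using assms(1)[unfolded noetherian_def, rule_format, of "approx p"]
      openin_approx approx_mono[of _ "Suc _"] by auto
  have "approx p k = U" if "K \<le> k" for k
    using approx_mono[OF that, of p] K UN_approx[OF assms(2)] by blast
  then show ?thesis using that by blast
qed

text \<open>The approximations attain the named open set, so an inclusion of \<open>U\<close> in it
  shows at a finite stage. Saturation holds because \<open>U\<close> is its own open
  superset.\<close>

lemma noetherian_open_compact:
  assumes noetherian "openin T U"
  shows "\<exists>c. compacts X c = Some U"
proof -
  let ?F = "\<lambda>p k. if U \<subseteq> approx p k then 1 else 0 :: nat"
  have "opens (opens X) (name ?F) = Some (open_supersets X U)"
    unfolding opens_def[of "opens X"]
  proof (rule subsets_via_name)
    show "local_map ?F"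
      unfolding local_map_def
    proof (intro allI impI)
      fix p p' k assume "agree k p p'"
      from approx_local[OF this] show "?F p k = ?F p' k" by simp
    qed
    show "open_supersets X U \<subseteq> points (opens X)" by (auto simp: open_supersets_def)
    fix p V assume V: "opens X p = Some V"
    obtain K where "\<And>k. K \<le> k \<Longrightarrow> approx p k = V" using approx_stabilizes[OF assms(1) V] by blast
    then have "(\<exists>k. U \<subseteq> approx p k) \<longleftrightarrow> U \<subseteq> V"
      using UN_approx[OF V] by blast
    moreover have "V \<in> points (opens X)" using V by (auto simp: ran_def)
    ultimately show "Sierpinski (?F p) = Some (V \<in> open_supersets X U)"
      by (auto simp: Sierpinski_def open_supersets_def)
  qed
  moreover have "saturated X U"
    using assms(2) by (auto simp: saturated_def open_supersets_def points_opens)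
  moreover have "U \<subseteq> points X" using assms(2) by (simp add: openin_pt_iff)
  ultimately show ?thesis by (auto simp: compacts_eq_Some_iff)
qed

text \<open>The guess at stage \<open>k\<close> is the set \<open>approx p k\<close> itself; it is
  open, hence compact, and the oracle supplies a chosen compact name.\<close>

lemma noetherian_imp_nabla_Noetherian:
  assumes noetherian
  shows "\<exists>q. nabla_Noetherian_rel q X"
proof -
  define c where "c U = (SOME c. compacts X c = Some U)" for U
  have c: "compacts X (c U) = Some U" if "openin T U" for U
    unfolding c_def using noetherian_open_compact[OF assms that] by (rule someI_ex)
  have "\<exists>q. computable_rel q (opens X) (nabla (compacts X)) (\<lambda>U. U)"
  proof (rule computable_rel_local_map)
    show "local_map (\<lambda>p. mindchange (approx p) c)"
      unfolding local_map_def
    proof (intro allI impI)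
      fix p p' k assume k: "agree k p p'"
      show "mindchange (approx p) c k = mindchange (approx p') c k"
        by (rule mindchange_cong) (simp_all add: approx_local[OF agree_mono[OF k]])
    qed
    fix p U assume U: "opens X p = Some U"
    then have "openin T U" using points_opens by (auto simp: ran_def)
    then show "nabla (compacts X) (mindchange (approx p) c) = Some U"
      using approx_stabilizes[OF assms U] nabla_mindchange[of _ "approx p" U "compacts X" c U] c
      by blast
  qed
  moreover have "points (opens X) \<subseteq> points (compacts X)"
    using c unfolding points_opens by (blast intro: ranI)
  ultimately show ?thesis by (simp add: nabla_Noetherian_rel_def)
qed

text \<open>
  A name of the union of an increasing sequence of open sets can be chosen such that each
  finite part of it also begins a name of a member of the sequence.
\<close>

lemma compact_opens_imp_noetherian:
  assumes "points (opens X) \<subseteq> points (compacts X)"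
  shows noetherian
  unfolding noetherian_def
proof (intro allI impI)
  fix V :: "nat \<Rightarrow> 'a set"
  assume V: "\<forall>k. openin T (V k)" and mono: "\<forall>k. V k \<subseteq> V (Suc k)"
  let ?U = "\<Union> (range V)"
  have le: "V k \<subseteq> V l" if "k \<le> l" for k l
    using lift_Suc_mono_le[of V k l] mono that by blast
  have "openin T ?U" using V by (intro openin_Union) auto
  then obtain c where "compacts X c = Some ?U"
    using assms points_opens by (force simp: ran_def)
  then have c: "opens (opens X) c = Some (open_supersets X ?U)"
    by (simp add: compacts_eq_Some_iff)
  note D = subsets_viaD(2)[OF c[unfolded opens_def[of "opens X"]]]
  have U: "opens X (open_name V) = Some ?U" using opens_open_name V mono by auto
  from D[OF U] obtain u where u: "\<forall>k. eval_at c (open_name V) k = Some (u k)"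
      "Sierpinski u = Some (?U \<in> open_supersets X ?U)" by metis
  have "?U \<in> open_supersets X ?U" using \<open>openin T ?U\<close> by (simp add: open_supersets_def points_opens)
  then obtain j where j: "u j \<noteq> 0" using u(2) by (auto simp: Sierpinski_def)
  obtain N where N: "\<And>p'. agree N (open_name V) p' \<Longrightarrow> eval_at c p' j = Some (u j)"
    using eval_at_use[of c "open_name V" j "u j"] u(1) by (metis agree_refl)
  \<comment> \<open>Stopping the chain at \<open>N\<close> keeps the part of the name that the
    accepting computation has read, while the union shrinks to \<open>V N\<close>.\<close>
  define W where "W k = V (min k N)" for k
  have W: "opens X (open_name W) = Some (\<Union>k. W k)"
    using V by (intro opens_open_name) (auto simp: W_def intro!: le)
  have "agree N (open_name V) (open_name W)"
    unfolding open_name_def by (rule agree_name) (simp add: W_def)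
  then have "eval_at c (open_name W) j = Some (u j)" by (rule N)
  with D[OF W] j have "(\<Union>k. W k) \<in> open_supersets X ?U"
    by (auto simp: Sierpinski_def)
  then have "?U \<subseteq> (\<Union>k. W k)" by (simp add: open_supersets_def)
  also have "\<dots> \<subseteq> V N" by (auto simp: W_def intro: le[THEN subsetD, rotated])
  finally show "\<exists>k. V k = ?U" by blast
qed


section \<open>Noetherian spaces and \<open>isFull\<close>\<close>

lemma Delta02D:
  assumes "Delta02 X p = Some A"
  shows "A \<subseteq> points X" "eval_at p r n = Some (the (eval_at p r n))"
    "nabla Sierpinski (\<lambda>n. the (eval_at p r n)) = Some (pt r \<in> A)"
proof -
  note D = subsets_viaD[OF assms[unfolded Delta02_def]]
  show "A \<subseteq> points X" by (rule D(1))
  obtain u where u: "\<forall>k. eval_at p r k = Some (u k)" "nabla Sierpinski u = Some (pt r \<in> A)"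
    using D(2)[OF X_eq] by blast
  have "u = (\<lambda>n. the (eval_at p r n))" using u(1) by simp
  then show "eval_at p r n = Some (the (eval_at p r n))"
    "nabla Sierpinski (\<lambda>n. the (eval_at p r n)) = Some (pt r \<in> A)"
    using u by auto
qed

text \<open>
  Every name satisfies one of countably many closed conditions \<open>R i\<close>, each of which forces the
  verdict \<open>b i\<close>. The guess at each stage is the first condition that has not been refuted.
\<close>

lemma isFull_by_refutation:
  fixes R :: "nat \<Rightarrow> baire \<Rightarrow> nat \<Rightarrow> nat \<Rightarrow> bool" and b :: "nat \<Rightarrow> bool"
  assumes complete: "\<And>p A. Delta02 X p = Some A \<Longrightarrow> \<exists>i. \<forall>r n. R i r n (the (eval_at p r n))"
    and sound: "\<And>p A i. Delta02 X p = Some A \<Longrightarrow> \<forall>r n. R i r n (the (eval_at p r n)) \<Longrightarrow>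
      b i \<longleftrightarrow> A = points X"
  shows "\<exists>q. nabla_compact_rel q X"
proof -
  define valid where "valid p i \<longleftrightarrow> p \<in> dom (Delta02 X) \<and> (\<forall>r n. R i r n (the (eval_at p r n)))"
    for p i
  \<comment> \<open>Asking for a valid extension of the prefix treats all \<open>r\<close> and
    \<open>n\<close> at once; a violated condition is excluded as soon as the prefix fixes the
    offending value.\<close>
  define alive where "alive p k i \<longleftrightarrow> (\<exists>p'. agree k p p' \<and> valid p' i)" for p k i
  define g where "g p k = (LEAST i. alive p k i)" for p k
  define c where "c i = (\<lambda>_::nat. if b i then 1 else 0 :: nat)" for i
  have alive_local: "alive p k = alive p' k" if "agree k p p'" for p p' k
    using that unfolding alive_def by (meson agree_sym agree_trans)
  have g_local: "g p k = g p' k" if "agree k p p'" for p p' k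
    unfolding g_def alive_local[OF that] ..
  have "\<exists>q. computable_rel q (Delta02 X) (nabla Sierpinski) (\<lambda>A. A = points X)"
  proof (rule computable_rel_local_map)
    show "local_map (\<lambda>p. mindchange (g p) c)"
      unfolding local_map_def
    proof (intro allI impI)
      fix p p' k assume k: "agree k p p'"
      show "mindchange (g p) c k = mindchange (g p') c k"
        by (rule mindchange_cong) (simp_all add: g_local[OF agree_mono[OF k]])
    qed
    fix p A assume A: "Delta02 X p = Some A"
    then have p: "p \<in> dom (Delta02 X)" by blast
    define i where "i = (LEAST i. valid p i)"
    have "\<exists>i. valid p i" using complete[OF A] p by (auto simp: valid_def)
    then have i: "valid p i" unfolding i_def by (rule LeastI_ex)
    have "\<forall>\<^sub>F k in sequentially. \<not> alive p k i'" if "i' < i" for i'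
    proof -
      have "\<not> valid p i'" using that not_less_Least unfolding i_def by blast
      then obtain r n where bad: "\<not> R i' r n (the (eval_at p r n))" using p by (auto simp: valid_def)
      obtain N where N: "\<And>p' r'. agree N p p' \<Longrightarrow> agree N r r' \<Longrightarrow>
          eval_at p' r' n = Some (the (eval_at p r n))"
        using eval_at_use[OF Delta02D(2)[OF A]] by blast
      have "\<not> alive p k i'" if "N \<le> k" for k
      proof
        assume "alive p k i'"
        then obtain p' where p': "agree k p p'" "valid p' i'" by (auto simp: alive_def)
        have "eval_at p' r n = Some (the (eval_at p r n))"
          using N[OF agree_mono[OF p'(1) that] agree_refl] .
        then have "R i' r n (the (eval_at p r n))" using p'(2) unfolding valid_def by (metis option.sel)
        then show False using bad by blast
      qed
      then show ?thesis by (rule eventually_sequentiallyI)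
    qed
    then have "\<forall>\<^sub>F k in sequentially. \<forall>i'\<in>{..<i}. \<not> alive p k i'"
      by (intro eventually_ball_finite) auto
    then obtain K where K: "\<forall>k\<ge>K. \<forall>i'\<in>{..<i}. \<not> alive p k i'"
      unfolding eventually_sequentially by blast
    have "g p k = i" if "K \<le> k" for k
      unfolding g_def
    proof (rule Least_equality)
      show "alive p k i" using i unfolding alive_def by (blast intro: agree_refl)
      show "i \<le> i'" if "alive p k i'" for i'
        using K \<open>K \<le> k\<close> that by (meson lessThan_iff not_le)
    qed
    moreover have "Sierpinski (c i) = Some (A = points X)"
      using sound[OF A] i by (auto simp: Sierpinski_def c_def valid_def)
    ultimately show "nabla Sierpinski (mindchange (g p) c) = Some (A = points X)"
      by (rule nabla_mindchange[where c = c and a = i])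
  qed
  then show ?thesis by (simp add: nabla_compact_rel_def)
qed

text \<open>Pairs of numbers keep the certificates in a countable type. A pair that codes no prefix
  denotes the empty set.\<close>

definition cylinder :: "nat \<times> nat \<Rightarrow> baire set" where
  "cylinder \<sigma> = {r. prefix_code r (fst \<sigma>) = snd \<sigma>}"

lemma in_cylinder_iff: "r' \<in> cylinder (N, prefix_code r N) \<longleftrightarrow> agree N r r'"
  by (auto simp: cylinder_def prefix_code_eq_iff agree_sym)

lemma openin_pt_cylinder: "openin T (pt ` cylinder \<sigma>)"
proof (rule openin_pt_image)
  fix r assume "r \<in> cylinder \<sigma>"
  then have "\<forall>r'. agree (fst \<sigma>) r r' \<longrightarrow> r' \<in> cylinder \<sigma>"
    by (auto simp: cylinder_def prefix_code_eq_iff[symmetric])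
  then show "\<exists>N. \<forall>r'. agree N r r' \<longrightarrow> r' \<in> cylinder \<sigma>" by blast
qed

text \<open>
  An entry \<open>(\<sigma>, s, j)\<close> certifies that outside the open set \<open>U\<close> collected so far, all points with
  a name in the cylinder \<open>\<sigma>\<close> are accepted, with the last mindchange before \<open>s\<close>. After the last
  entry, either \<open>U\<close> is everything, or \<open>Some (\<sigma>, s)\<close> certifies that the remaining points of
  \<open>\<sigma>\<close> are rejected.
\<close>

primrec check :: "((nat \<times> nat) \<times> nat) option \<Rightarrow> 'a set \<Rightarrow> ((nat \<times> nat) \<times> nat \<times> nat) list \<Rightarrow>
    baire \<Rightarrow> nat \<Rightarrow> nat \<Rightarrow> bool" where
  "check e U [] r n v = (case e of
       None \<Rightarrow> U = points X
     | Some (\<sigma>, s) \<Rightarrow> (\<exists>r'\<in>cylinder \<sigma>. pt r' \<notin> U) \<and>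
         (r \<in> cylinder \<sigma> \<longrightarrow> pt r \<notin> U \<longrightarrow> (s \<le> n \<longrightarrow> v = 1) \<and> (Suc n = s \<longrightarrow> v = 0)))"
| "check e U (x # xs) r n v = (case x of (\<sigma>, s, j) \<Rightarrow> s \<le> j \<and>
     (r \<in> cylinder \<sigma> \<longrightarrow> pt r \<notin> U \<longrightarrow> (s \<le> n \<longrightarrow> v \<noteq> 0) \<and> (n = j \<longrightarrow> 2 \<le> v)) \<and>
     check e (U \<union> pt ` cylinder \<sigma>) xs r n v)"

text \<open>Each entry keeps the collected set inside \<open>A\<close> by
  \<open>nabla_Sierpinski_TrueI\<close>; a final \<open>Some\<close> demands a witness outside
  \<open>U\<close>, rejected by \<open>nabla_Sierpinski_FalseI\<close>.\<close>

lemma check_sound: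
  assumes u: "\<And>r. nabla Sierpinski (u r) = Some (pt r \<in> A)" and "A \<subseteq> points X"
    and "U \<subseteq> A" and "\<forall>r n. check e U xs r n (u r n)"
  shows "e = None \<longleftrightarrow> A = points X"
  using assms(3,4)
proof (induction xs arbitrary: U)
  case Nil
  show ?case
  proof (cases e)
    case None
    then show ?thesis using Nil assms(2) by auto
  next
    case (Some y)
    obtain \<sigma> s where y: "y = (\<sigma>, s)" by (cases y)
    obtain r where r: "r \<in> cylinder \<sigma>" "pt r \<notin> U" using Nil(2) by (auto simp: Some y)
    then have "s \<le> n \<Longrightarrow> u r n = 1" "Suc n = s \<Longrightarrow> u r n = 0" for n
      using Nil(2) by (auto simp: Some y)
    then have "pt r \<notin> A" by (rule nabla_Sierpinski_FalseI[OF u])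
    then show ?thesis using Some pt_in_points by blast
  qed
next
  case (Cons x xs)
  obtain \<sigma> s j where x: "x = (\<sigma>, s, j)" by (cases x)
  have "pt r \<in> A" if r: "r \<in> cylinder \<sigma>" "pt r \<notin> U" for r
  proof (rule nabla_Sierpinski_TrueI[OF u])
    show "s \<le> j" "2 \<le> u r j" "\<And>n. s \<le> n \<Longrightarrow> u r n \<noteq> 0" using Cons.prems(2) r by (auto simp: x)
  qed
  then have "U \<union> pt ` cylinder \<sigma> \<subseteq> A" using Cons.prems(1) by blast
  moreover have "\<forall>r n. check e (U \<union> pt ` cylinder \<sigma>) xs r n (u r n)"
    using Cons.prems(2) by (simp add: x)
  ultimately show ?case by (rule Cons.IH)
qed

lemma wf_noetherian:
  assumes noetherian
  shows "wf {(V, U). openin T V \<and> openin T U \<and> U \<subset> V}"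
  unfolding wf_iff_no_infinite_down_chain
proof
  assume "\<exists>f. \<forall>i. (f (Suc i), f i) \<in> {(V, U). openin T V \<and> openin T U \<and> U \<subset> V}"
  then obtain f where "\<forall>i. (f (Suc i), f i) \<in> {(V, U). openin T V \<and> openin T U \<and> U \<subset> V}" ..
  then have f: "\<forall>i. openin T (f i)" "\<forall>i. f i \<subset> f (Suc i)" by simp_all
  then obtain k where "f k = \<Union> (range f)"
    using assms[unfolded noetherian_def, rule_format, of f] by blast
  then show False using f(2)[rule_format, of k] by blast
qed

text \<open>Induction with larger open sets first. Category yields a cylinder on which the
  mindchanges outside \<open>U\<close> end by a common bound. If some point there is accepted, a
  smaller cylinder around a name of it is accepted outside \<open>U\<close> and enlarges
  \<open>U\<close>; otherwise the cylinder is rejected outside \<open>U\<close> and the list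
  ends.\<close>

lemma check_complete:
  assumes noetherian and u: "\<And>r. nabla Sierpinski (u r) = Some (pt r \<in> A)"
    and cont: "\<And>r k. \<exists>N. \<forall>r'. agree N r r' \<longrightarrow> u r' k = u r k"
    and "openin T U"
  shows "\<exists>e xs. \<forall>r n. check e U xs r n (u r n)"
  using assms(4)
proof (induction U rule: wf_induct_rule[OF wf_noetherian[OF assms(1)]])
  case (1 U)
  show ?case
  proof (cases "U = points X")
    case True
    then have "\<forall>r n. check None U [] r n (u r n)" by simp
    then show ?thesis by blast
  next
    case False
    define D where "D = {r. pt r \<notin> U}"
    have "U \<subseteq> range pt" using 1(2) by (simp add: openin_pt_iff points_eq)
    then obtain r0 where r0: "pt r0 \<notin> U" using False unfolding points_eq by blast
    have "\<exists>r\<in>D. \<exists>N s. \<forall>r'\<in>D. agree N r r' \<longrightarrow> (\<forall>n\<ge>s. u r' n \<noteq> 0)"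
    proof (rule Baire_no_late_zeros)
      show "r0 \<in> D" using r0 by (simp add: D_def)
      show "r \<in> D" if r: "\<And>N. \<exists>r'\<in>D. agree N r r'" for r
      proof (rule ccontr)
        assume "r \<notin> D"
        then have "pt r \<in> U" by (simp add: D_def)
        then obtain N where "\<forall>r'. agree N r r' \<longrightarrow> pt r' \<in> U"
          using 1(2) openin_pt_iff by blast
        then show False using r[of N] by (auto simp: D_def)
      qed
      show "\<exists>N. \<forall>r'. agree N r r' \<longrightarrow> u r' k = u r k" for r k by (rule cont)
      show "\<exists>s. \<forall>n\<ge>s. u r n \<noteq> 0" for r using nabla_SierpinskiD[OF u[of r]] by blast
    qed
    then obtain r N s where r: "r \<in> D"
      and late: "\<forall>r'\<in>D. agree N r r' \<longrightarrow> (\<forall>n\<ge>s. u r' n \<noteq> 0)" by blast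
    show ?thesis
    proof (cases "\<exists>r1\<in>D. agree N r r1 \<and> pt r1 \<in> A")
      case True
      then obtain r1 where r1: "r1 \<in> D" "agree N r r1" "pt r1 \<in> A" by blast
      obtain s1 j where s1: "\<forall>n\<ge>s1. u r1 n \<noteq> 0" "s1 \<le> j" "2 \<le> u r1 j"
        using nabla_SierpinskiD[OF u[of r1]] r1(3) by blast
      \<comment> \<open>Zeros from \<open>s1\<close> on are excluded before \<open>s\<close> by
        agreement with \<open>r1\<close>, and from \<open>s\<close> on by \<open>late\<close>;
        \<open>Suc j\<close> preserves the accepting entry too.\<close>
      obtain N1 where N1: "\<forall>r'. agree N1 r1 r' \<longrightarrow> (\<forall>k<max s (Suc j). u r' k = u r1 k)"
        using prefix_bound[where u = u, OF cont] by blast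
      define N2 where "N2 = max N N1"
      define \<sigma> where "\<sigma> = (N2, prefix_code r1 N2)"
      have entry: "(s1 \<le> n \<longrightarrow> u r' n \<noteq> 0) \<and> (n = j \<longrightarrow> 2 \<le> u r' n)"
        if "r' \<in> cylinder \<sigma>" "pt r' \<notin> U" for r' n
      proof -
        have "agree N2 r1 r'" using that(1) by (simp add: \<sigma>_def in_cylinder_iff)
        then have ag: "agree N r r'" "agree N1 r1 r'"
          using agree_trans[OF r1(2)] agree_mono unfolding N2_def by (meson max.cobounded1 max.cobounded2)+
        moreover have "r' \<in> D" using that(2) by (simp add: D_def)
        ultimately have "\<forall>n\<ge>s. u r' n \<noteq> 0" "\<forall>k<max s (Suc j). u r' k = u r1 k"
          using late N1 by blast+
        then show ?thesis using s1 by (metis less_max_iff_disj lessI not_le)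
      qed
      define U' where "U' = U \<union> pt ` cylinder \<sigma>"
      have "r1 \<in> cylinder \<sigma>" by (simp add: \<sigma>_def in_cylinder_iff)
      then have "U \<subset> U'" using r1(1) by (auto simp: D_def U'_def)
      moreover have "openin T U'" using 1(2) openin_pt_cylinder unfolding U'_def by blast
      ultimately obtain e xs where "\<forall>r n. check e U' xs r n (u r n)" using 1 by blast
      then have "\<forall>r n. check e U ((\<sigma>, s1, j) # xs) r n (u r n)"
        using entry s1(2) by (auto simp: U'_def)
      then show ?thesis by blast
    next
      case False
      have "pt r \<notin> A" using False r agree_refl by blast
      then obtain s1 where s1: "\<forall>n. Suc n = s1 \<longrightarrow> u r n = 0" "\<forall>n\<ge>s1. u r n \<noteq> 0"
        using nabla_SierpinskiD[OF u[of r]] by blast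
      obtain N1 where N1: "\<forall>r'. agree N1 r r' \<longrightarrow> (\<forall>k<max s s1. u r' k = u r k)"
        using prefix_bound[where u = u, OF cont] by blast
      define N2 where "N2 = max N N1"
      define \<sigma> where "\<sigma> = (N2, prefix_code r N2)"
      have "(s1 \<le> n \<longrightarrow> u r' n = 1) \<and> (Suc n = s1 \<longrightarrow> u r' n = 0)"
        if "r' \<in> cylinder \<sigma>" "pt r' \<notin> U" for r' n
      proof -
        have "agree N2 r r'" using that(1) by (simp add: \<sigma>_def in_cylinder_iff)
        then have ag: "agree N r r'" "agree N1 r r'"
          using agree_mono unfolding N2_def by (meson max.cobounded1 max.cobounded2)+
        moreover have "r' \<in> D" using that(2) by (simp add: D_def)
        ultimately have vals: "\<forall>n\<ge>s. u r' n \<noteq> 0" "\<forall>k<max s s1. u r' k = u r k"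
          using late N1 by blast+
        have nz: "u r' m \<noteq> 0" if "s1 \<le> m" for m
          using vals s1(2) that by (metis less_max_iff_disj not_le)
        have "pt r' \<notin> A" using False ag(1) that(2) by (auto simp: D_def)
        \<comment> \<open>With no zeros left, an entry of at least 2 would accept a point where none
          is accepted.\<close>
        then have "\<not> 2 \<le> u r' m" if "s1 \<le> m" for m
          using nabla_Sierpinski_TrueI[OF u[of r'] nz that] by blast
        then have "u r' n = 1" if "s1 \<le> n" using nz[OF that] that by force
        moreover have "u r' n = 0" if "Suc n = s1" using vals(2) s1(1) that by auto
        ultimately show ?thesis by blast
      qed
      moreover have "\<exists>r'\<in>cylinder \<sigma>. pt r' \<notin> U"
        using r by (intro bexI[of _ r]) (auto simp: D_def \<sigma>_def in_cylinder_iff)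
      ultimately have "\<forall>r n. check (Some (\<sigma>, s1)) U [] r n (u r n)" by simp
      then show ?thesis by blast
    qed
  qed
qed

text \<open>\<open>from_nat\<close> enumerates the certificates. \<open>check\<close> constrains one
  value for each \<open>r\<close> and \<open>n\<close>; its conditions on sets alone are repeated
  for every pair.\<close>

lemma noetherian_imp_nabla_compact:
  assumes noetherian
  shows "\<exists>q. nabla_compact_rel q X"
proof (rule isFull_by_refutation)
  let ?c = "\<lambda>i. from_nat i :: ((nat \<times> nat) \<times> nat) option \<times> ((nat \<times> nat) \<times> nat \<times> nat) list"
  fix p A assume A: "Delta02 X p = Some A"
  note u = Delta02D(3)[OF A]
  have "\<exists>N. \<forall>r'. agree N r r' \<longrightarrow> the (eval_at p r' k) = the (eval_at p r k)" for r k
  proof -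
    obtain N where "\<And>p' r'. agree N p p' \<Longrightarrow> agree N r r' \<Longrightarrow>
        eval_at p' r' k = Some (the (eval_at p r k))"
      using eval_at_use[OF Delta02D(2)[OF A]] by blast
    then have "\<forall>r'. agree N r r' \<longrightarrow> the (eval_at p r' k) = the (eval_at p r k)"
      using agree_refl by (metis option.sel)
    then show ?thesis by blast
  qed
  from check_complete[OF assms u this openin_empty]
  obtain e xs where "\<forall>r n. check e {} xs r n (the (eval_at p r n))" by blast
  then have "\<forall>r n. check (fst (?c (to_nat (e, xs)))) {} (snd (?c (to_nat (e, xs)))) r n
      (the (eval_at p r n))" by simp
  then show "\<exists>i. \<forall>r n. check (fst (?c i)) {} (snd (?c i)) r n (the (eval_at p r n))" by blast
  show "fst (?c i) = None \<longleftrightarrow> A = points X"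
    if "\<forall>r n. check (fst (?c i)) {} (snd (?c i)) r n (the (eval_at p r n))" for i
    by (rule check_sound[OF u Delta02D(1)[OF A] _ that]) simp
qed

text \<open>
  If \<open>V\<close> is increasing but not eventually constant, then for \<open>b\<close> in Baire space the set that omits
  \<open>V (Suc i) - V i\<close> unless \<open>b\<close> has a nonzero entry from \<open>i\<close> on is full iff \<open>b\<close> has infinitely
  many nonzero entries, and this cannot be decided with finitely many mindchanges.
\<close>

lemma nabla_compact_imp_noetherian:
  assumes "nabla_compact_rel q X"
  shows noetherian
  unfolding noetherian_def
proof (intro allI impI, rule ccontr)
  fix V :: "nat \<Rightarrow> 'a set"
  assume V: "\<forall>k. openin T (V k)" and mono: "\<forall>k. V k \<subseteq> V (Suc k)"
    and "\<not> (\<exists>k. V k = \<Union> (range V))"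
  then have proper: "V k \<noteq> \<Union> (range V)" for k by blast
  have le: "V k \<subseteq> V l" if "k \<le> l" for k l
    using lift_Suc_mono_le[of V k l] mono that by blast
  define inf_many where "inf_many b \<longleftrightarrow> (\<forall>i. \<exists>j\<ge>i. b j \<noteq> 0)" for b :: baire
  define A where "A b = {x \<in> points X. \<forall>i. x \<in> V (Suc i) - V i \<longrightarrow> (\<exists>j\<ge>i. b j \<noteq> 0)}"
    for b :: baire
  define seen where "seen r k i \<longleftrightarrow> (\<forall>r'. agree k r r' \<longrightarrow> pt r' \<in> V i)" for r k i
  define g where "g r k = (if \<exists>i. seen r k i then Suc (LEAST i. seen r k i) else 0)" for r k
  \<comment> \<open>Guess 0 means that no \<open>V i\<close> has been seen, \<open>Suc i\<close>
    that \<open>i\<close> is the least index seen. Only \<open>Suc (Suc i)\<close>, for a point new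
    in \<open>V (Suc i)\<close>, imposes a condition. The bound \<open>j < m\<close> makes entry
    \<open>m\<close> depend on \<open>b\<close> below \<open>m\<close> only.\<close>
  define c where "c b l m =
    (if \<forall>i. l = Suc (Suc i) \<longrightarrow> (\<exists>j\<ge>i. j < m \<and> b j \<noteq> 0) then 1 else 0 :: nat)"
    for b :: baire and l m :: nat
  define F where "F b r = mindchange (g r) (c b)" for b r
  have seen_local: "seen r k = seen r' k" if "agree k r r'" for r r' k
    using that unfolding seen_def by (meson agree_sym agree_trans)
  have g_local: "g r k = g r' k" if "agree k r r'" for r r' k
    unfolding g_def seen_local[OF that] ..
  have F_local: "local_map (F b)" for b
    unfolding local_map_def
  proof (intro allI impI)
    fix r r' k assume k: "agree k r r'"
    show "F b r k = F b r' k" unfolding F_def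
      by (rule mindchange_cong) (simp_all add: g_local[OF agree_mono[OF k]])
  qed
  have F_A: "nabla Sierpinski (F b r) = Some (pt r \<in> A b)" for b r
  proof (cases "\<exists>i. pt r \<in> V i")
    case True
    define i where "i = (LEAST i. pt r \<in> V i)"
    have i: "pt r \<in> V i" unfolding i_def using True by (rule LeastI_ex)
    have least: "i \<le> i'" if "pt r \<in> V i'" for i' unfolding i_def using that by (rule Least_le)
    obtain N where N: "\<forall>r'. agree N r r' \<longrightarrow> pt r' \<in> V i"
      using V i openin_pt_iff by blast
    have "g r k = Suc i" if "N \<le> k" for k
    proof -
      have "seen r k i" using N agree_mono that unfolding seen_def by blast
      moreover have "i \<le> i'" if "seen r k i'" for i'
        using that agree_refl least unfolding seen_def by blast
      ultimately have "(LEAST i. seen r k i) = i" by (rule Least_equality)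
      then show ?thesis using \<open>seen r k i\<close> unfolding g_def by auto
    qed
    moreover have "Sierpinski (c b (Suc i)) = Some (pt r \<in> A b)"
    proof -
      have "pt r \<in> V (Suc i') - V i' \<longleftrightarrow> i = Suc i'" for i'
      proof
        assume *: "pt r \<in> V (Suc i') - V i'"
        then have "i \<le> Suc i'" using least by blast
        moreover have "\<not> i \<le> i'" using * i le by blast
        ultimately show "i = Suc i'" by simp
      next
        assume "i = Suc i'"
        then show "pt r \<in> V (Suc i') - V i'" using i least[of i'] by auto
      qed
      then have "pt r \<in> A b \<longleftrightarrow> (\<forall>i'. i = Suc i' \<longrightarrow> (\<exists>j\<ge>i'. b j \<noteq> 0))"
        by (simp add: A_def)
      also have "\<dots> \<longleftrightarrow> (\<exists>m. \<forall>i'. i = Suc i' \<longrightarrow> (\<exists>j\<ge>i'. j < m \<and> b j \<noteq> 0))"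
        by (cases i) auto
      also have "\<dots> \<longleftrightarrow> (\<exists>m. c b (Suc i) m \<noteq> 0)"
        by (auto simp: c_def)
      finally show ?thesis by (simp only: Sierpinski_def)
    qed
    ultimately show ?thesis
      unfolding F_def by (rule nabla_mindchange[where c = "c b" and a = "Suc i"])
  next
    case False
    then have "\<not> seen r k i" for k i using agree_refl unfolding seen_def by blast
    then have "g r k = 0" for k by (simp add: g_def)
    moreover have "Sierpinski (c b 0) = Some (pt r \<in> A b)"
      using False by (auto simp: Sierpinski_def c_def A_def)
    ultimately show ?thesis
      unfolding F_def by (intro nabla_mindchange[where c = "c b" and a = 0])
  qed
  have A_name: "Delta02 X (name (F b)) = Some (A b)" for b
    unfolding Delta02_def
  proof (rule subsets_via_name[OF F_local])
    show "nabla Sierpinski (F b r) = Some (x \<in> A b)" if "X r = Some x" for r x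
      using F_A[of b r] that by (simp add: X_eq)
  qed (auto simp: A_def)
  have A_full: "A b = points X \<longleftrightarrow> inf_many b" for b
  proof
    assume full: "A b = points X"
    show "inf_many b"
      unfolding inf_many_def
    proof
      fix i
      have "\<exists>k\<ge>i. V k \<noteq> V (Suc k)"
      proof (rule ccontr)
        assume "\<not> ?thesis"
        then have "\<forall>k\<ge>i. V k = V (Suc k)" by blast
        have "V k = V i" if "i \<le> k" for k
          using that
        proof (induction k rule: dec_induct)
          case (step k)
          then show ?case using \<open>\<forall>k\<ge>i. V k = V (Suc k)\<close> by metis
        qed simp
        then have "V k \<subseteq> V i" for k using le[of k i] le[of i k] nat_le_linear[of i k] by blast
        then show False using proper[of i] by blast
      qed
      then obtain k x where k: "i \<le> k" "x \<in> V (Suc k) - V k" using mono by blast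
      have "V (Suc k) \<subseteq> points X" using V by (simp add: openin_pt_iff)
      then have "x \<in> A b" using full k(2) by blast
      then have "\<exists>j\<ge>k. b j \<noteq> 0" using k(2) unfolding A_def by blast
      then show "\<exists>j\<ge>i. b j \<noteq> 0" using k(1) le_trans by blast
    qed
  next
    assume "inf_many b"
    then show "A b = points X" unfolding A_def inf_many_def by blast
  qed
  obtain n where n: "realizes (Delta02 X) (nabla Sierpinski) (machine n q) (\<lambda>A. A = points X)"
    using assms unfolding nabla_compact_rel_def computable_rel_def by blast
  define H where "H b = the (machine n q (name (F b)))" for b
  have H: "machine n q (name (F b)) = Some (H b)" "nabla Sierpinski (H b) = Some (inf_many b)" for b
    using n[unfolded realizes_def, rule_format, OF A_name[of b]] A_full[of b]
    by (auto simp: H_def)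
  have H_run: "run q (name (F b)) (prog_of_nat n) k = Some (H b k)" for b k
    using H(1)[of b] by (simp add: machine_eq_Some_iff)
  \<comment> \<open>Entry \<open>i\<close> of \<open>F b r\<close> reads \<open>b\<close> only below
    \<open>i\<close>, so a prefix of \<open>b\<close> determines a prefix of
    \<open>name (F b)\<close>, and the use principle passes this on to \<open>H b\<close>.\<close>
  have cont: "\<exists>N. \<forall>b'. agree N b b' \<longrightarrow> H b' k = H b k" for b k
  proof -
    obtain N where N: "\<And>q' p'. agree N q q' \<Longrightarrow> agree N (name (F b)) p' \<Longrightarrow>
        run q' p' (prog_of_nat n) k = Some (H b k)"
      using run_use[OF H_run] by blast
    have "H b' k = H b k" if "agree N b b'" for b'
    proof -
      have "F b r i = F b' r i" if "i < N" for r i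
        unfolding F_def
      proof (rule mindchange_cong)
        fix m assume "m < i"
        then have "\<forall>j<m. b j = b' j" using \<open>agree N b b'\<close> that by (auto simp: agree_def)
        then show "c b (g r i) m = c b' (g r i) m" unfolding c_def by metis
      qed simp
      then have "agree N (name (F b)) (name (F b'))" by (rule agree_name)
      then show ?thesis using N[OF agree_refl] H_run[of b' k] by simp
    qed
    then show ?thesis by blast
  qed
  have "\<exists>b\<in>UNIV. \<exists>N s. \<forall>b'\<in>UNIV. agree N b b' \<longrightarrow> (\<forall>n\<ge>s. H b' n \<noteq> 0)"
    by (rule Baire_no_late_zeros[OF UNIV_I UNIV_I cont]) (use nabla_SierpinskiD[OF H(2)] in blast)
  then obtain b N s where late: "\<And>b' n. agree N b b' \<Longrightarrow> s \<le> n \<Longrightarrow> H b' n \<noteq> 0" by blast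
  \<comment> \<open>Continuing the prefix with ones forces acceptance, which already shows in a
    finite part of \<open>b1\<close>.\<close>
  define b1 where "b1 i = (if i < N then b i else 1)" for i
  have "b1 (max i N) \<noteq> 0" for i by (simp add: b1_def)
  then have "inf_many b1" unfolding inf_many_def using max.cobounded1 by blast
  then obtain s1 j where s1: "\<forall>n\<ge>s1. H b1 n \<noteq> 0" "s1 \<le> j" "2 \<le> H b1 j"
    using nabla_SierpinskiD[OF H(2)[of b1]] by blast
  obtain N1 where N1: "\<forall>b'. agree N1 b1 b' \<longrightarrow> (\<forall>k<max s (Suc j). H b' k = H b1 k)"
    using prefix_bound[where u = H, OF cont] by blast
  \<comment> \<open>Zeros after that part cannot undo the acceptance, since late zeros in
    \<open>H b2\<close> are excluded, yet only finitely many nonzero entries remain.\<close>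
  define b2 where "b2 i = (if i < max N N1 then b1 i else 0)" for i
  have "agree N b b2" "agree N1 b1 b2" by (auto simp: agree_def b1_def b2_def)
  then have vals: "\<And>n. s \<le> n \<Longrightarrow> H b2 n \<noteq> 0" "\<forall>k<max s (Suc j). H b2 k = H b1 k"
    using late N1 by blast+
  have "inf_many b2"
  proof (rule nabla_Sierpinski_TrueI[OF H(2)])
    show "s1 \<le> j" by fact
    show "2 \<le> H b2 j" using s1(3) vals(2) by simp
    show "H b2 n \<noteq> 0" if "s1 \<le> n" for n
      using vals s1(1) that by (metis less_max_iff_disj not_le)
  qed
  then obtain i where "max N N1 \<le> i" "b2 i \<noteq> 0" unfolding inf_many_def by blast
  then show False by (simp add: b2_def split: if_splits)
qed

end

theorem theorem49:
  fixes T :: "'a topology" and X :: "'a rep_space"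
  assumes "quasi_Polish T"
    and "open_admissible_total_rep T X"
  shows "(\<exists>q. nabla_compact_rel q X) \<longleftrightarrow> (\<exists>q. nabla_Noetherian_rel q X)"
proof -
  note rep = assms(2)[unfolded open_admissible_total_rep_def]
  note final = rep[THEN conjunct2, THEN conjunct2, THEN conjunct1]
    and open_map = rep[THEN conjunct2, THEN conjunct2, THEN conjunct2, THEN conjunct1]
  interpret total_open_rep T X
    by (rule total_open_rep.intro[OF rep[THEN conjunct1] rep[THEN conjunct2, THEN conjunct1]
        final[rule_format] open_map[rule_format]])
  have "noetherian" if "nabla_Noetherian_rel q X" for q
    using that compact_opens_imp_noetherian unfolding nabla_Noetherian_rel_def by blast
  then show ?thesis
    using nabla_compact_imp_noetherian noetherian_imp_nabla_Noetherian
      noetherian_imp_nabla_compact by blast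
qed

end
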